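(* Let $n\ge1$. The map $\xi$ is an involution on $\mathrm{NC}(n)$ with $\operatorname{type}(\xi(\pi))=\operatorname{type}(\pi)$, $\operatorname{nn}(\xi(\pi))=\operatorname{na}(\pi)$ and $\operatorname{na}(\xi(\pi))=\operatorname{nn}(\pi)$ for all $\pi\in\mathrm{NC}(n)$. Moreover, if $\{N_1,\dots,N_r\}_<$ and $\{N'_1,\dots,N'_s\}_<$ are the sets of nonnested blocks of $\pi$ and $\xi(\pi)$ respectively, and $\{A_1,\dots,A_s\}_<$ and $\{A'_1,\dots,A'_r\}_<$ are the sets of nonaligned blocks of $\pi$ and $\xi(\pi)$ respectively, then $|N_i|=|A'_i|$ for all $i\in[r]$ and $|A_j|=|N'_j|$ for all $j\in[s]$.
   Context: $[n]=\{1,\dots,n\}$. An edge of a partition of $[n]$ is a pair $(i,j)$, $i<j$, in the same block with no element of that block strictly between. $\mathrm{NC}(n)$ is the set of partitions of $[n]$ with no two edges $(a,b),(c,d)$, $a<c<b<d$; $\mathrm{NC}(0)=\{\emptyset\}$. A block $B$ of $\pi$ is nonnested if there is no edge $(i,j)$ with $i<\min B\le\max B<j$, and nonaligned if there is no edge $(i,j)$ with $\max B<i$; $\operatorname{nn}(\pi)$, $\operatorname{na}(\pi)$ are their numbers. The type of $\pi$ is the multiset of block sizes. $\{A_1,\dots,A_k\}_<$ means $\max A_1<\cdots<\max A_k$. Operations: for $\sigma\in\mathrm{NC}(a)$, $\tau\in\mathrm{NC}(b)$ ($a,b\ge0$), $\sigma\uplus\tau\in\mathrm{NC}(a+b)$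 consists of the blocks of $\sigma$ and the blocks of $\tau$ with all elements increased by $a$. $\sigma\in\mathrm{NC}(a)$, $a\ge1$, is connected if $1$ and $a$ lie in one block. For $\sigma\in\mathrm{NC}(a)$ connected or $\sigma=\emptyset$, and $\tau\in\mathrm{NC}(b)$, $\sigma*\tau\in\mathrm{NC}(a+b+1)$ is obtained from $\sigma\uplus\tau$ by adding $a+b+1$ to the block containing $a$ if $a\ge1$, and as a new singleton block if $\sigma=\emptyset$. For $\pi\in\mathrm{NC}(n)$ and $S=\{s_1<\cdots<s_k\}\subseteq[n]$, $\pi\cap S\in\mathrm{NC}(k)$ is obtained by restricting $\pi$ to $S$ and replacing $s_i$ by $i$. If $\{n\}$ is not a block of $\pi\in\mathrm{NC}(n)$, let $B$ be the block containing $n$, $a=\min B$, $b$ the second largest element of $B$; then $\pi=\sigma\uplus(\tau*\upsilon)$ with $\sigma=\pi\cap[1,a-1]$, $\tau=\pi\cap[a,b]$ (connected), $\upsilon=\pi\cap[b+1,n-1]$, and we set $\mathrm{decomp}_1(\pi)=\mathrm{decomp}_2(\pi)=(\sigma,\tau,\upsilon)$. If $\{n\}$ is a block, $\mathrm{decomp}_1(\pi)=(\pi\cap[n-1],\emptyset,\emptyset)$ and $\mathrm{decomp}_2(\pi)=(\emptyset,\emptyset,\pi\cap[n-1])$. Definition of $\xi$: first let $\pi\in\mathrm{NC}(n)$ with $\{n\}$ not a block. Put $\pi_1=\pi$ and $(\pi_{i+1},\sigma_i,\sigma'_i)=\mathrm{decomp}_1(\pi_i)$ while $\pi_i\neq\emptyset$,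 and let $r$ be such that $\pi_{r+1}=\emptyset$. Put $\upsilon_1=\pi$ and $(\tau'_i,\tau_i,\upsilon_{i+1})=\mathrm{decomp}_2(\upsilon_i)$ while $\upsilon_i\ne\emptyset$, and let $s$ be such that $\upsilon_{s+1}=\emptyset$ (note $\sigma_1=\tau_1$). Let $M_{r+1}=\emptyset$ and $M_i=\sigma'_i\uplus(\sigma_i*M_{i+1})$ for $i=r,r-1,\dots,2$. Then $\xi(\pi)=(\tau_s*\tau'_s)\uplus\cdots\uplus(\tau_2*\tau'_2)\uplus(\sigma_1*M_2)$. For general $\pi\in\mathrm{NC}(n)$, let $k$ be the largest element of $[n]$ such that $\{k\}$ is not a block of $\pi$; then $\xi(\pi)$ is $\xi(\pi\cap[k])$ together with the singleton blocks $\{k+1\},\dots,\{n\}$ (if all blocks of $\pi$ are singletons, $\xi(\pi)=\pi$). *)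

theory Defs
  imports "HOL-Library.Disjoint_Sets" "HOL-Library.Multiset" "HOL-Library.FuncSet"
begin

text \<open>A partition of \<open>{1..n}\<close> is a set of blocks, i.e. an element of type \<open>nat set set\<close>; the empty
  set is the only partition of \<open>{1..0} = {}\<close>.\<close>

definition edge :: "nat set set \<Rightarrow> nat \<Rightarrow> nat \<Rightarrow> bool" where
  "edge \<pi> i j \<longleftrightarrow> i < j \<and> (\<exists>B\<in>\<pi>. i \<in> B \<and> j \<in> B \<and> \<not> (\<exists>k\<in>B. i < k \<and> k < j))"

definition NC :: "nat \<Rightarrow> nat set set set" where
  "NC n = {\<pi>. partition_on {1..n} \<pi> \<and>
              \<not> (\<exists>a b c d. edge \<pi> a b \<and> edge \<pi> c d \<and> a < c \<and> c < b \<and> b < d)}"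

definition nonnested :: "nat set set \<Rightarrow> nat set set" where
  "nonnested \<pi> = {B \<in> \<pi>. \<not> (\<exists>i j. edge \<pi> i j \<and> i < Min B \<and> Max B < j)}"

definition nonaligned :: "nat set set \<Rightarrow> nat set set" where
  "nonaligned \<pi> = {B \<in> \<pi>. \<not> (\<exists>i j. edge \<pi> i j \<and> Max B < i)}"

definition nn :: "nat set set \<Rightarrow> nat" where
  "nn \<pi> = card (nonnested \<pi>)"

definition na :: "nat set set \<Rightarrow> nat" where
  "na \<pi> = card (nonaligned \<pi>)"

definition ptype :: "nat set set \<Rightarrow> nat multiset" where
  "ptype \<pi> = image_mset card (mset_set \<pi>)"

text \<open>\<open>ordered_blocks As \<A>\<close> is \<open>\<A> = {A\<^sub>1, \<dots>, A\<^sub>k}\<^sub><\<close>, with the list \<open>As = [A\<^sub>1, \<dots>, A\<^sub>k]\<close>;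
  for the list index, \<open>A\<^sub>i\<close> is \<open>As ! (i - 1)\<close>.\<close>

definition ordered_blocks :: "nat set list \<Rightarrow> nat set set \<Rightarrow> bool" where
  "ordered_blocks As \<A> \<longleftrightarrow> set As = \<A> \<and> sorted_wrt (\<lambda>A B. Max A < Max B) As"

text \<open>Every set of blocks of a partition has exactly one such enumeration.\<close>

lemma ordered_blocks_ex1:
  assumes "\<pi> \<in> NC n" and "\<A> \<subseteq> \<pi>"
  shows "\<exists>!As. ordered_blocks As \<A>"
proof -
  have part: "partition_on {1..n} \<pi>"
    using assms(1) by (simp add: NC_def)
  have fin: "finite \<A>"
    using finite_elements[OF _ part] assms(2) finite_subset by blast
  have mem: "finite B \<and> B \<noteq> {}" if "B \<in> \<A>" for B
    using that assms(2) part unfolding partition_on_def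
    by (metis Union_upper finite_atLeastAtMost finite_subset subsetD)
  have inj: "inj_on Max \<A>"
  proof (rule inj_onI)
    fix B C assume "B \<in> \<A>" "C \<in> \<A>" "Max B = Max C"
    then have "Max B \<in> B \<inter> C" using mem Max_in by (metis IntI)
    then show "B = C"
      using part assms(2) \<open>B \<in> \<A>\<close> \<open>C \<in> \<A>\<close> unfolding partition_on_def disjoint_def by blast
  qed
  let ?As = "map (inv_into \<A> Max) (sorted_list_of_set (Max ` \<A>))"
  have Max_As: "map Max ?As = sorted_list_of_set (Max ` \<A>)"
    unfolding map_map by (rule map_idI) (simp add: f_inv_into_f fin)
  have ex: "ordered_blocks ?As \<A>"
  proof -
    have "set ?As = \<A>" using inj fin by simp
    moreover have "sorted_wrt (<) (map Max ?As)"
      unfolding Max_As by (rule strict_sorted_list_of_set)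
    ultimately show ?thesis by (simp add: ordered_blocks_def sorted_wrt_map)
  qed
  have uniq: "As = Bs" if "ordered_blocks As \<A>" "ordered_blocks Bs \<A>" for As Bs
  proof -
    have sets: "set As = \<A>" "set Bs = \<A>"
      using that by (simp_all add: ordered_blocks_def)
    have "map Max As = map Max Bs"
    proof (rule strict_sorted_equal)
      show "sorted_wrt (<) (map Max As)" "sorted_wrt (<) (map Max Bs)"
        using that by (simp_all add: ordered_blocks_def sorted_wrt_map)
      show "set (map Max As) = set (map Max Bs)"
        by (simp add: sets)
    qed
    then show ?thesis
      by (rule map_inj_on) (use inj in \<open>simp add: sets\<close>)
  qed
  from ex uniq show ?thesis by blast
qed

text \<open>The \<open>n\<close> for which \<open>\<pi>\<close> is a partition of \<open>{1..n}\<close>.\<close>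

definition psize :: "nat set set \<Rightarrow> nat" where
  "psize \<pi> = card (\<Union>\<pi>)"

definition juxt :: "nat set set \<Rightarrow> nat set set \<Rightarrow> nat set set"  (infixr "\<uplus>" 65) where
  "\<sigma> \<uplus> \<tau> = \<sigma> \<union> (\<lambda>B. (\<lambda>x. x + psize \<sigma>) ` B) ` \<tau>"

text \<open>A total function; it has the intended meaning if \<open>\<sigma>\<close> is connected or empty.\<close>

definition star :: "nat set set \<Rightarrow> nat set set \<Rightarrow> nat set set"  (infixr "\<star>" 70) where
  "\<sigma> \<star> \<tau> =
     (let a = psize \<sigma>; b = psize \<tau>
      in if \<sigma> = {} then insert {a + b + 1} (\<sigma> \<uplus> \<tau>)
         else (\<lambda>B. if a \<in> B then insert (a + b + 1) B else B) ` (\<sigma> \<uplus> \<tau>))"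

text \<open>\<open>\<pi> \<inter> S\<close> of the mathematics. For \<open>S = {s\<^sub>1 < \<dots> < s\<^sub>k}\<close>, the number of elements \<open>t \<le> s\<^sub>i\<close> of
  \<open>S\<close> is \<open>i\<close>.\<close>

definition restr :: "nat set set \<Rightarrow> nat set \<Rightarrow> nat set set" where
  "restr \<pi> S = (\<lambda>B. (\<lambda>s. card {t \<in> S. t \<le> s}) ` (B \<inter> S)) ` \<pi> - {{}}"

definition decomp_nonsingleton ::
    "nat set set \<Rightarrow> nat set set \<times> nat set set \<times> nat set set" where
  "decomp_nonsingleton \<pi> =
     (let n = psize \<pi>; B = (THE B. B \<in> \<pi> \<and> n \<in> B); a = Min B; b = Max (B - {n})
      in (restr \<pi> {1..<a}, restr \<pi> {a..b}, restr \<pi> {b+1..<n}))"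

definition decomp1 :: "nat set set \<Rightarrow> nat set set \<times> nat set set \<times> nat set set" where
  "decomp1 \<pi> =
     (let n = psize \<pi>
      in if {n} \<in> \<pi> then (restr \<pi> {1..<n}, {}, {}) else decomp_nonsingleton \<pi>)"

definition decomp2 :: "nat set set \<Rightarrow> nat set set \<times> nat set set \<times> nat set set" where
  "decomp2 \<pi> =
     (let n = psize \<pi>
      in if {n} \<in> \<pi> then ({}, {}, restr \<pi> {1..<n}) else decomp_nonsingleton \<pi>)"

text \<open>The sequences \<open>\<pi>\<^sub>i\<close>, \<open>\<sigma>\<^sub>i\<close>, \<open>\<sigma>'\<^sub>i\<close> and \<open>\<upsilon>\<^sub>i\<close>, \<open>\<tau>'\<^sub>i\<close>, \<open>\<tau>\<^sub>i\<close> are indexed from 1. Being values of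
  total functions, they are also defined beyond \<open>i = r + 1\<close> and \<open>i = s + 1\<close>, where they are never
  used.\<close>

definition pi_seq :: "nat set set \<Rightarrow> nat \<Rightarrow> nat set set" where
  "pi_seq \<pi> i = ((\<lambda>\<rho>. fst (decomp1 \<rho>)) ^^ (i - 1)) \<pi>"

definition sigma_seq :: "nat set set \<Rightarrow> nat \<Rightarrow> nat set set" where
  "sigma_seq \<pi> i = fst (snd (decomp1 (pi_seq \<pi> i)))"

definition sigma'_seq :: "nat set set \<Rightarrow> nat \<Rightarrow> nat set set" where
  "sigma'_seq \<pi> i = snd (snd (decomp1 (pi_seq \<pi> i)))"

definition r_len :: "nat set set \<Rightarrow> nat" where
  "r_len \<pi> = (LEAST r. pi_seq \<pi> (r + 1) = {})"

definition upsilon_seq :: "nat set set \<Rightarrow> nat \<Rightarrow> nat set set" where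
  "upsilon_seq \<pi> i = ((\<lambda>\<rho>. snd (snd (decomp2 \<rho>))) ^^ (i - 1)) \<pi>"

definition tau'_seq :: "nat set set \<Rightarrow> nat \<Rightarrow> nat set set" where
  "tau'_seq \<pi> i = fst (decomp2 (upsilon_seq \<pi> i))"

definition tau_seq :: "nat set set \<Rightarrow> nat \<Rightarrow> nat set set" where
  "tau_seq \<pi> i = fst (snd (decomp2 (upsilon_seq \<pi> i)))"

definition s_len :: "nat set set \<Rightarrow> nat" where
  "s_len \<pi> = (LEAST s. upsilon_seq \<pi> (s + 1) = {})"

text \<open>\<open>M_part \<pi> i\<close> is \<open>M\<^sub>i\<close>: it is \<open>{}\<close> for \<open>i = r + 1\<close>, and for \<open>i \<le> r\<close> it is
  \<open>\<sigma>'\<^sub>i \<uplus> (\<sigma>\<^sub>i \<star> M_part \<pi> (i + 1))\<close>.\<close>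

definition M_part :: "nat set set \<Rightarrow> nat \<Rightarrow> nat set set" where
  "M_part \<pi> i =
     foldr (\<lambda>j M. sigma'_seq \<pi> j \<uplus> (sigma_seq \<pi> j \<star> M)) [i..<r_len \<pi> + 1] {}"

text \<open>The case in which the largest element is not a singleton block.\<close>

definition xi_nonsingleton :: "nat set set \<Rightarrow> nat set set" where
  "xi_nonsingleton \<pi> =
     foldr (\<uplus>) (map (\<lambda>i. tau_seq \<pi> i \<star> tau'_seq \<pi> i) (rev [2..<s_len \<pi> + 1]))
       (sigma_seq \<pi> 1 \<star> M_part \<pi> 2)"

definition xi :: "nat set set \<Rightarrow> nat set set" where
  "xi \<pi> =
     (let n = psize \<pi>; K = {k \<in> {1..n}. {k} \<notin> \<pi>}; k = Max K
      in if K = {} then \<pi>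
         else xi_nonsingleton (restr \<pi> {1..k}) \<union> (\<lambda>j. {j}) ` {k+1..n})"

end

theory Submission
  imports Defs
begin

text \<open>Iterating \<open>decomp\<^sub>1\<close> writes a noncrossing partition uniquely as
  \<open>(\<sigma>\<^sub>r \<star> \<sigma>'\<^sub>r) \<uplus> \<dots> \<uplus> (\<sigma>\<^sub>1 \<star> \<sigma>'\<^sub>1)\<close>, and iterating \<open>decomp\<^sub>2\<close> writes it uniquely as
  \<open>\<tau>'\<^sub>1 \<uplus> (\<tau>\<^sub>1 \<star> (\<tau>'\<^sub>2 \<uplus> (\<tau>\<^sub>2 \<star> \<dots>)))\<close>. In both cases the data is an arbitrary list of pairs consisting of
  a connected partition and a partition, or of two empty ones. If the largest element is not a
  singleton, then \<open>\<pi> = \<rho> \<uplus> (\<sigma>\<^sub>1 \<star> \<upsilon>)\<close>, where \<open>\<rho>\<close> has a list of the first kind and \<open>\<upsilon>\<close> one of the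
  second kind, and \<open>\<xi>\<close> merely exchanges these two lists. Hence \<open>\<xi>\<close> is an involution, and it
  preserves the type since both readings of a list have the same block sizes. The nonnested blocks
  are the outer blocks of the first expression, the nonaligned blocks those of the second one, and
  their sizes depend on the connected components \<open>\<sigma>\<^sub>i\<close>, \<open>\<tau>\<^sub>i\<close> only.\<close>

section \<open>Noncrossing partitions\<close>

text \<open>Decomposing a built partition returns the list it was built from, so the sequences,
  lengths and indices in the definition of \<xi> are only ever evaluated on built partitions, where
  they become heads, tails and lengths of lists. Three points shape the rest. Trailing singletons,
  which \<xi> leaves in place, appear in both readings as pairs of empty partitions at the head of
  the list. The left list of \<pi> and the right list of \<xi>(\<pi>) do not coincide: in the pair
  of \<sigma> the second component is \<open>buildR qs\<close> in the one and
  \<open>buildL qs\<close> in the other. Only the first components agree, and this is why block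
  sizes have to be expressed through them. Finally, edges behave badly under the operations, since
  they change when a block gains or loses an element; crossing, nesting and alignment are therefore
  first rephrased through arbitrary elements of blocks.\<close>

definition shift :: "nat \<Rightarrow> nat set set \<Rightarrow> nat set set" where
  "shift p \<pi> = (\<lambda>B. (\<lambda>x. x + p) ` B) ` \<pi>"

text \<open>Crossings are tested on four arbitrary points rather than on edges. Deleting an element
  of a block can create an edge, whereas this condition survives passing to fewer blocks or deleting
  elements. \<open>NC_iff\<close> shows that it agrees with the condition on edges.\<close>

definition noncrossing :: "nat set set \<Rightarrow> bool" where
  "noncrossing \<pi> \<longleftrightarrow> (\<forall>B\<in>\<pi>. \<forall>C\<in>\<pi>. \<forall>a\<in>B. \<forall>b\<in>C. \<forall>c\<in>B. \<forall>d\<in>C.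
     a < b \<longrightarrow> b < c \<longrightarrow> c < d \<longrightarrow> B = C)"

definition valid :: "nat set set \<Rightarrow> bool" where
  "valid \<pi> \<longleftrightarrow> partition_on {1..psize \<pi>} \<pi> \<and> noncrossing \<pi>"

lemma noncrossingD:
  assumes "noncrossing \<pi>" "B \<in> \<pi>" "C \<in> \<pi>" "a \<in> B" "b \<in> C" "c \<in> B" "d \<in> C"
    "a < b" "b < c" "c < d"
  shows "B = C"
  using assms unfolding noncrossing_def by blast

lemma valid_bounds: "valid \<pi> \<Longrightarrow> B \<in> \<pi> \<Longrightarrow> x \<in> B \<Longrightarrow> 1 \<le> x \<and> x \<le> psize \<pi>"
  unfolding valid_def partition_on_def by fastforce

lemma valid_subset: "valid \<pi> \<Longrightarrow> B \<in> \<pi> \<Longrightarrow> B \<subseteq> {1..psize \<pi>}"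
  using valid_bounds by fastforce

lemma valid_cover: "valid \<pi> \<Longrightarrow> 1 \<le> x \<Longrightarrow> x \<le> psize \<pi> \<Longrightarrow> \<exists>B\<in>\<pi>. x \<in> B"
  unfolding valid_def partition_on_def by (metis UnionE atLeastAtMost_iff)

lemma valid_disjoint: "valid \<pi> \<Longrightarrow> B \<in> \<pi> \<Longrightarrow> C \<in> \<pi> \<Longrightarrow> x \<in> B \<Longrightarrow> x \<in> C \<Longrightarrow> B = C"
  unfolding valid_def partition_on_def disjoint_def by blast

lemma valid_nonempty: "valid \<pi> \<Longrightarrow> B \<in> \<pi> \<Longrightarrow> B \<noteq> {}"
  unfolding valid_def partition_on_def by blast

lemma valid_finite_block: "valid \<pi> \<Longrightarrow> B \<in> \<pi> \<Longrightarrow> finite B"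
  using valid_subset finite_subset by blast

lemma valid_finite: "valid \<pi> \<Longrightarrow> finite \<pi>"
  unfolding valid_def using finite_elements by blast

lemma valid_noncrossing: "valid \<pi> \<Longrightarrow> noncrossing \<pi>"
  unfolding valid_def by blast

lemma valid_Max: "valid \<pi> \<Longrightarrow> B \<in> \<pi> \<Longrightarrow> Max B \<in> B"
  by (simp add: valid_finite_block valid_nonempty)

lemma valid_Min: "valid \<pi> \<Longrightarrow> B \<in> \<pi> \<Longrightarrow> Min B \<in> B"
  by (simp add: valid_finite_block valid_nonempty)

lemma validI:
  assumes "\<And>B. B \<in> \<pi> \<Longrightarrow> B \<noteq> {} \<and> B \<subseteq> {1..n}"
    and "\<And>x. 1 \<le> x \<Longrightarrow> x \<le> n \<Longrightarrow> \<exists>B\<in>\<pi>. x \<in> B"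
    and "\<And>B C x. B \<in> \<pi> \<Longrightarrow> C \<in> \<pi> \<Longrightarrow> x \<in> B \<Longrightarrow> x \<in> C \<Longrightarrow> B = C"
    and "noncrossing \<pi>"
  shows "valid \<pi> \<and> psize \<pi> = n"
proof -
  have "\<Union>\<pi> = {1..n}" using assms(1,2) by fastforce
  moreover have "psize \<pi> = n" unfolding psize_def calculation by simp
  moreover have "disjoint \<pi>" using assms(3) unfolding disjoint_def by blast
  ultimately show ?thesis using assms(1,4) unfolding valid_def partition_on_def by auto
qed

lemma psize_empty [simp]: "psize {} = 0"
  by (simp add: psize_def)

lemma valid_empty [simp]: "valid {}"
  by (simp add: valid_def partition_on_def noncrossing_def)

lemma valid_psize_0: "valid \<pi> \<Longrightarrow> psize \<pi> = 0 \<longleftrightarrow> \<pi> = {}"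
  unfolding valid_def partition_on_def by auto

text \<open>The neighbours of the threshold \<open>t\<close> in the block, namely its largest
  element up to \<open>t\<close> and its smallest beyond \<open>t\<close>, form the edge. This turns
  any two elements around \<open>t\<close> into an edge around \<open>t\<close>.\<close>

lemma edge_in_block:
  assumes "B \<in> \<pi>" "x \<in> B" "y \<in> B" "x \<le> t" "t < y" "finite B"
  obtains i j where "edge \<pi> i j" "i \<in> B" "j \<in> B" "x \<le> i" "i \<le> t" "t < j" "j \<le> y"
proof -
  define i where "i = Max {z \<in> B. z \<le> t}"
  define j where "j = Min {z \<in> B. t < z}"
  have i: "i \<in> {z \<in> B. z \<le> t}" unfolding i_def by (rule Max_in) (use assms in auto)
  have j: "j \<in> {z \<in> B. t < z}" unfolding j_def by (rule Min_in) (use assms in auto)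
  have ix: "z \<le> i" if "z \<in> B" "z \<le> t" for z
    unfolding i_def by (rule Max_ge) (use assms that in auto)
  have jy: "j \<le> z" if "z \<in> B" "t < z" for z
    unfolding j_def by (rule Min_le) (use assms that in auto)
  have "\<not> (\<exists>k\<in>B. i < k \<and> k < j)" using ix jy by (meson leD leI)
  then have "edge \<pi> i j" unfolding edge_def using i j assms(1) by auto
  then show ?thesis using i j ix[OF assms(2,4)] jy[OF assms(3,5)] that by blast
qed

text \<open>From crossing points \<open>a < b < c < d\<close> crossing edges are found in two steps:
  first the edge \<open>(i, j)\<close> of \<open>B\<close> around \<open>b\<close>, then the edge
  \<open>(k, l)\<close> of \<open>C\<close> around \<open>j\<close>. Disjointness of the blocks
  makes the inequalities \<open>i < k < j < l\<close> strict. Conversely, crossing edges lie in one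
  block, and then one of them has an element strictly inside.\<close>

lemma NC_iff: "\<pi> \<in> NC n \<longleftrightarrow> valid \<pi> \<and> psize \<pi> = n"
proof
  assume \<pi>: "\<pi> \<in> NC n"
  then have part: "partition_on {1..n} \<pi>" by (simp add: NC_def)
  then have size: "psize \<pi> = n" unfolding partition_on_def psize_def by simp
  have fin: "finite B" if "B \<in> \<pi>" for B
    using part that unfolding partition_on_def by (metis Union_upper finite_atLeastAtMost finite_subset)
  have "B = C" if h: "B \<in> \<pi>" "C \<in> \<pi>" "a \<in> B" "b \<in> C" "c \<in> B" "d \<in> C" "a < b" "b < c" "c < d"
    for a b c d B C
  proof (rule ccontr)
    assume "B \<noteq> C"
    then have disj: "B \<inter> C = {}"
      using part h unfolding partition_on_def disjoint_def by blast
    obtain i j where ij: "edge \<pi> i j" "j \<in> B" "i \<in> B" "i \<le> b" "b < j" "j \<le> c"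
      by (rule edge_in_block[of B \<pi> a c b]) (use h fin[of B] in auto)
    have "i \<noteq> b" using ij disj h by auto
    obtain k l where kl: "edge \<pi> k l" "k \<in> C" "l \<in> C" "b \<le> k" "k \<le> j" "j < l" "l \<le> d"
      by (rule edge_in_block[of C \<pi> b d j]) (use h fin[of C] ij in auto)
    have "k \<noteq> j" using kl ij disj by auto
    then have "i < k" "k < j" "j < l" using ij kl \<open>i \<noteq> b\<close> by auto
    then show False using ij(1) kl(1) \<pi> unfolding NC_def by blast
  qed
  then have "noncrossing \<pi>" unfolding noncrossing_def by blast
  then show "valid \<pi> \<and> psize \<pi> = n" using size part by (simp add: valid_def)
next
  assume v: "valid \<pi> \<and> psize \<pi> = n"
  have False if e: "edge \<pi> a b" "edge \<pi> c d" and lt: "a < c" "c < b" "b < d" for a b c d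
  proof -
    obtain B where B: "B \<in> \<pi>" "a \<in> B" "b \<in> B" "\<not> (\<exists>k\<in>B. a < k \<and> k < b)"
      using e(1) unfolding edge_def by blast
    obtain C where C: "C \<in> \<pi>" "c \<in> C" "d \<in> C" using e(2) unfolding edge_def by blast
    have "B = C" using noncrossingD[OF valid_noncrossing, of \<pi> B C a c b d] v B C lt by simp
    then show False using B C lt by blast
  qed
  then show "\<pi> \<in> NC n" using v unfolding NC_def valid_def by blast
qed

section \<open>The two operations\<close>

lemma shift_0 [simp]: "shift 0 \<pi> = \<pi>"
  by (simp add: shift_def)

lemma shift_empty [simp]: "shift p {} = {}"
  by (simp add: shift_def)

lemma shift_shift: "shift p (shift q \<pi>) = shift (q + p) \<pi>"
  unfolding shift_def by (simp add: image_image add.assoc)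

lemma shift_Un: "shift p (\<sigma> \<union> \<tau>) = shift p \<sigma> \<union> shift p \<tau>"
  unfolding shift_def by (simp add: image_Un)

lemma juxt_eq: "\<sigma> \<uplus> \<tau> = \<sigma> \<union> shift (psize \<sigma>) \<tau>"
  by (simp add: juxt_def shift_def)

lemma juxt_empty [simp]: "{} \<uplus> \<tau> = \<tau>" "\<sigma> \<uplus> {} = \<sigma>"
  by (simp_all add: juxt_eq)

lemma inj_shift_block: "inj (\<lambda>B. (\<lambda>x::nat. x + p) ` B)"
  by (rule injI) (simp add: inj_image_eq_iff)

lemma valid_juxt:
  assumes "valid \<sigma>" "valid \<tau>"
  shows "valid (\<sigma> \<uplus> \<tau>) \<and> psize (\<sigma> \<uplus> \<tau>) = psize \<sigma> + psize \<tau>"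
proof (rule validI)
  let ?s = "psize \<sigma>" and ?t = "psize \<tau>"
  note b\<sigma> = valid_bounds[OF assms(1)] and b\<tau> = valid_bounds[OF assms(2)]
  have cases: "(B \<in> \<sigma> \<and> B \<subseteq> {1..?s}) \<or> (\<exists>C\<in>\<tau>. B = (\<lambda>x. x + ?s) ` C \<and> B \<subseteq> {?s+1..?s+?t})"
    if "B \<in> \<sigma> \<uplus> \<tau>" for B
    using that valid_subset[OF assms(1)] b\<tau> unfolding juxt_def by fastforce
  fix B C :: "nat set" and x :: nat
  {
    assume "B \<in> \<sigma> \<uplus> \<tau>"
    then show "B \<noteq> {} \<and> B \<subseteq> {1..?s + ?t}"
      using cases[of B] valid_nonempty[OF assms(1)] valid_nonempty[OF assms(2)] by fastforce
  next
    assume x: "1 \<le> x" "x \<le> ?s + ?t"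
    show "\<exists>B\<in>\<sigma> \<uplus> \<tau>. x \<in> B"
    proof (cases "x \<le> ?s")
      case True
      then show ?thesis using valid_cover[OF assms(1) x(1)] by (auto simp: juxt_def)
    next
      case False
      then obtain C where "C \<in> \<tau>" "x - ?s \<in> C" 
        using valid_cover[OF assms(2), of "x - ?s"] x by force
      then have "x \<in> (\<lambda>x. x + ?s) ` C" using False by force
      then show ?thesis using \<open>C \<in> \<tau>\<close> unfolding juxt_def by blast
    qed
  next
    assume "B \<in> \<sigma> \<uplus> \<tau>" "C \<in> \<sigma> \<uplus> \<tau>" "x \<in> B" "x \<in> C"
    then consider "B \<in> \<sigma>" "C \<in> \<sigma>"
      | B' C' where "B' \<in> \<tau>" "C' \<in> \<tau>" "B = (\<lambda>x. x + ?s) ` B'" "C = (\<lambda>x. x + ?s) ` C'"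
      using cases[of B] cases[of C] by fastforce
    then show "B = C"
    proof cases
      case 1
      then show ?thesis using valid_disjoint[OF assms(1)] \<open>x \<in> B\<close> \<open>x \<in> C\<close> by blast
    next
      case 2
      then have "x - ?s \<in> B'" "x - ?s \<in> C'" using \<open>x \<in> B\<close> \<open>x \<in> C\<close> by auto
      then show ?thesis using 2 valid_disjoint[OF assms(2) 2(1,2)] by blast
    qed
  }
  show "noncrossing (\<sigma> \<uplus> \<tau>)"
    unfolding noncrossing_def
  proof (intro ballI impI)
    fix B C a b c d
    assume h: "B \<in> \<sigma> \<uplus> \<tau>" "C \<in> \<sigma> \<uplus> \<tau>" "a \<in> B" "b \<in> C" "c \<in> B" "d \<in> C" "a < b" "b < c" "c < d"
    consider "B \<in> \<sigma>" "C \<in> \<sigma>"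
      | B' C' where "B' \<in> \<tau>" "C' \<in> \<tau>" "B = (\<lambda>x. x + ?s) ` B'" "C = (\<lambda>x. x + ?s) ` C'"
      using cases[OF h(1)] cases[OF h(2)] h(3-) by fastforce
    then show "B = C"
    proof cases
      case 1
      then show ?thesis
        using noncrossingD[OF valid_noncrossing[OF assms(1)], of B C a b c d] h by simp
    next
      case 2
      obtain a' b' c' d' where "a' \<in> B'" "b' \<in> C'" "c' \<in> B'" "d' \<in> C'"
          "a = a' + ?s" "b = b' + ?s" "c = c' + ?s" "d = d' + ?s"
        using h 2 by blast
      then show ?thesis
        using noncrossingD[OF valid_noncrossing[OF assms(2)] 2(1,2), of a' b' c' d'] h 2 by simp
    qed
  qed
qed

lemma juxt_assoc:
  assumes "valid \<rho>" "valid \<sigma>"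
  shows "(\<rho> \<uplus> \<sigma>) \<uplus> \<tau> = \<rho> \<uplus> \<sigma> \<uplus> \<tau>"
  using valid_juxt[OF assms] by (simp add: juxt_eq shift_Un shift_shift Un_assoc add.commute)

section \<open>Connected partitions and the star operation\<close>

text \<open>A union rather than a definite description, so that the value is \<open>{}\<close> for
  the empty partition. Inserting the new largest element into it then covers both cases of
  \<open>star\<close>.\<close>

definition lastblock :: "nat set set \<Rightarrow> nat set" where
  "lastblock \<sigma> = \<Union>{B \<in> \<sigma>. psize \<sigma> \<in> B}"

definition conn_or_empty :: "nat set set \<Rightarrow> bool" where
  "conn_or_empty \<sigma> \<longleftrightarrow> \<sigma> = {} \<or> 1 \<in> lastblock \<sigma>"

lemma lastblock_empty [simp]: "lastblock {} = {}"
  by (simp add: lastblock_def)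

lemma lastblock_eq:
  assumes "valid \<sigma>" "B \<in> \<sigma>" "psize \<sigma> \<in> B"
  shows "lastblock \<sigma> = B"
proof -
  have "{B \<in> \<sigma>. psize \<sigma> \<in> B} = {B}" using assms valid_disjoint by blast
  then show ?thesis by (simp add: lastblock_def)
qed

lemma lastblock_in:
  assumes "valid \<sigma>" "\<sigma> \<noteq> {}"
  shows "lastblock \<sigma> \<in> \<sigma> \<and> psize \<sigma> \<in> lastblock \<sigma>"
proof -
  have "psize \<sigma> \<noteq> 0" using assms valid_psize_0 by blast
  then obtain B where "B \<in> \<sigma>" "psize \<sigma> \<in> B" using valid_cover[OF assms(1), of "psize \<sigma>"] by auto
  then show ?thesis using lastblock_eq[OF assms(1)] by blast
qed

lemma lastblock_bounds: "valid \<sigma> \<Longrightarrow> x \<in> lastblock \<sigma> \<Longrightarrow> 1 \<le> x \<and> x \<le> psize \<sigma>"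
  unfolding lastblock_def using valid_bounds by blast

lemma image_fixed: "(\<And>x. x \<in> X \<Longrightarrow> f x = x) \<Longrightarrow> f ` X = X"
  by force

text \<open>For nonempty \<open>\<sigma>\<close> the blocks of the shifted \<open>\<tau>\<close> lie
  above \<open>psize \<sigma>\<close>, so the map in the definition of \<open>star\<close> alters
  the last block only. For empty \<open>\<sigma>\<close> the inserted block is the new
  singleton.\<close>

lemma star_eq:
  assumes "valid \<sigma>" "valid \<tau>"
  shows "\<sigma> \<star> \<tau> = insert (insert (psize \<sigma> + psize \<tau> + 1) (lastblock \<sigma>))
    ((\<sigma> - {lastblock \<sigma>}) \<union> shift (psize \<sigma>) \<tau>)"
proof (cases "\<sigma> = {}")
  case True
  then show ?thesis by (simp add: star_def juxt_eq)
next
  case False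
  let ?a = "psize \<sigma>" and ?f = "\<lambda>B. if psize \<sigma> \<in> B then insert (psize \<sigma> + psize \<tau> + 1) B else B"
  have L: "lastblock \<sigma> \<in> \<sigma>" "?a \<in> lastblock \<sigma>" using lastblock_in assms False by auto
  have 1: "?f B = B" if "B \<in> \<sigma> - {lastblock \<sigma>}" for B
    using that lastblock_eq[OF assms(1)] by auto
  have 2: "?f B = B" if "B \<in> shift ?a \<tau>" for B
  proof -
    have "?a \<notin> B" using that valid_bounds[OF assms(2)] unfolding shift_def by force
    then show ?thesis by simp
  qed
  have "\<sigma> \<star> \<tau> = ?f ` (\<sigma> \<uplus> \<tau>)" using False by (simp add: star_def Let_def)
  also have "\<sigma> \<uplus> \<tau> = insert (lastblock \<sigma>) ((\<sigma> - {lastblock \<sigma>}) \<union> shift ?a \<tau>)"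
    using L by (auto simp: juxt_eq)
  also have "?f ` \<dots> = insert (?f (lastblock \<sigma>)) (?f ` (\<sigma> - {lastblock \<sigma>}) \<union> ?f ` shift ?a \<tau>)"
    by (simp only: image_insert image_Un)
  also have "?f ` (\<sigma> - {lastblock \<sigma>}) = \<sigma> - {lastblock \<sigma>}" by (rule image_fixed) (rule 1)
  also have "?f ` shift ?a \<tau> = shift ?a \<tau>" by (rule image_fixed) (rule 2)
  finally show ?thesis using L by simp
qed

lemma shift_insert: "shift p (insert B \<pi>) = insert ((\<lambda>x. x + p) ` B) (shift p \<pi>)"
  by (simp add: shift_def)

lemma shift_Diff: "shift p (\<sigma> - \<tau>) = shift p \<sigma> - shift p \<tau>"
  unfolding shift_def by (rule image_set_diff[OF inj_shift_block])

text \<open>Of four crossing points only the largest can be the new element. A crossing that was not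
  there before would thus be a block with elements on both sides of an element of \<open>L\<close>,
  and the last assumption excludes this. The case \<open>L = {}\<close> adds a singleton.\<close>

lemma insert_last_valid:
  assumes \<rho>: "valid \<rho>" and L: "L = {} \<or> L \<in> \<rho>"
    and exposed: "\<And>C x y z. C \<in> \<rho> \<Longrightarrow> x \<in> C \<Longrightarrow> y \<in> L \<Longrightarrow> z \<in> C \<Longrightarrow> x < y \<Longrightarrow> y < z \<Longrightarrow> C = L"
  shows "valid (insert (insert (psize \<rho> + 1) L) (\<rho> - {L})) \<and>
    psize (insert (insert (psize \<rho> + 1) L) (\<rho> - {L})) = psize \<rho> + 1"
proof (rule validI)
  let ?n = "psize \<rho> + 1"
  let ?\<pi> = "insert (insert ?n L) (\<rho> - {L})"
  note b = valid_bounds[OF \<rho>]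
  have Lb: "1 \<le> x \<and> x < ?n" if "x \<in> L" for x using L b[of L x] that by auto
  have nC: "?n \<notin> C" if "C \<in> \<rho>" for C using b[of C ?n] that by auto
  have disj: False if "C \<in> \<rho> - {L}" "x \<in> C" "x \<in> L" for C x
    using L valid_disjoint[OF \<rho>, of C L x] that by auto
  fix B C :: "nat set" and x :: nat
  {
    assume "B \<in> ?\<pi>"
    then show "B \<noteq> {} \<and> B \<subseteq> {1..?n}" using Lb b valid_nonempty[OF \<rho>] by fastforce
  next
    assume x: "1 \<le> x" "x \<le> ?n"
    show "\<exists>B\<in>?\<pi>. x \<in> B"
    proof (cases "x = ?n")
      case False
      then obtain C where "C \<in> \<rho>" "x \<in> C" using valid_cover[OF \<rho> x(1)] x by auto
      then show ?thesis by (cases "C = L") auto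
    qed auto
  next
    assume "B \<in> ?\<pi>" "C \<in> ?\<pi>" "x \<in> B" "x \<in> C"
    then show "B = C" using nC disj valid_disjoint[OF \<rho>, of B C x] by blast
  }
  show "noncrossing ?\<pi>" unfolding noncrossing_def
  proof (intro ballI impI)
    fix B C a b c d
    assume h: "B \<in> ?\<pi>" "C \<in> ?\<pi>" "a \<in> B" "b \<in> C" "c \<in> B" "d \<in> C" "a < b" "b < c" "c < d"
    have "d \<le> ?n" using h(2,6) Lb nC b[of C d] by fastforce
    then have le: "a \<noteq> ?n" "b \<noteq> ?n" "c \<noteq> ?n" using h by auto
    define B0 where "B0 = B - {?n}"
    have B0: "a \<in> B0" "c \<in> B0" using h le by (auto simp: B0_def)
    have B0': "B0 = L \<and> B = insert ?n L \<or> B0 = B \<and> B \<in> \<rho> - {L}"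
      using h(1) Lb nC by (auto simp: B0_def)
    show "B = C"
    proof (cases "C = insert ?n L")
      case True
      then have "b \<in> L" using h le by auto
      then have "B0 = L" using exposed[of B0 a b c] B0 B0' h by auto
      then show ?thesis using B0' True by auto
    next
      case False
      then have C: "C \<in> \<rho>" "C \<noteq> L" using h by auto
      show ?thesis
      proof (cases "B \<in> \<rho> - {L}")
        case True
        then show ?thesis
          using noncrossingD[OF valid_noncrossing[OF \<rho>], of B C a b c d] h C by simp
      next
        case False
        then have "B0 = L" using B0' by auto
        moreover from this have "B0 \<in> \<rho>" using L B0 by auto
        ultimately show ?thesis
          using noncrossingD[OF valid_noncrossing[OF \<rho>], of B0 C a b c d] h C B0 by auto
      qed
    qed
  qed
qed

text \<open>The last block \<open>L\<close> of \<open>\<sigma>\<close> is exposed in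
  \<open>\<sigma> \<uplus> \<tau>\<close>: a block with elements on both sides of an element of
  \<open>L\<close> lies in \<open>\<sigma>\<close>, and it would cross \<open>L\<close>, since
  \<open>psize \<sigma>\<close> belongs to \<open>L\<close>.\<close>

lemma valid_star:
  assumes "valid \<sigma>" "valid \<tau>"
  shows "valid (\<sigma> \<star> \<tau>) \<and> psize (\<sigma> \<star> \<tau>) = psize \<sigma> + psize \<tau> + 1"
proof -
  let ?L = "lastblock \<sigma>" and ?\<rho> = "\<sigma> \<uplus> \<tau>"
  have \<rho>: "valid ?\<rho>" "psize ?\<rho> = psize \<sigma> + psize \<tau>" using valid_juxt[OF assms] by auto
  have "?L \<notin> shift (psize \<sigma>) \<tau>"
  proof
    assume "?L \<in> shift (psize \<sigma>) \<tau>"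
    then obtain C where C: "C \<in> \<tau>" "?L = (\<lambda>x. x + psize \<sigma>) ` C" unfolding shift_def by auto
    then obtain x where "x \<in> C" using valid_nonempty[OF assms(2)] by blast
    then show False
      using C valid_bounds[OF assms(2) C(1), of x] lastblock_bounds[OF assms(1), of "x + psize \<sigma>"]
      by auto
  qed
  then have "?\<rho> - {?L} = (\<sigma> - {?L}) \<union> shift (psize \<sigma>) \<tau>"
    unfolding juxt_eq by blast
  then have eq: "\<sigma> \<star> \<tau> = insert (insert (psize ?\<rho> + 1) ?L) (?\<rho> - {?L})"
    by (simp only: star_eq[OF assms] \<rho>(2))
  have "?L = {} \<or> ?L \<in> ?\<rho>"
    using lastblock_in[OF assms(1)] by (cases "\<sigma> = {}") (auto simp: juxt_eq)
  moreover have "C = ?L"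
    if h: "C \<in> ?\<rho>" "x \<in> C" "y \<in> ?L" "z \<in> C" "x < y" "y < z" for C x y z
  proof -
    have ne: "\<sigma> \<noteq> {}" using h by auto
    note L = lastblock_in[OF assms(1) ne]
    have x: "x < psize \<sigma>" using lastblock_bounds[OF assms(1) h(3)] h by auto
    have "C \<in> \<sigma>"
    proof (rule ccontr)
      assume "C \<notin> \<sigma>"
      then show False using h(1,2) x by (auto simp: juxt_eq shift_def)
    qed
    moreover have "z \<le> psize \<sigma>" using valid_bounds[OF assms(1) \<open>C \<in> \<sigma>\<close> h(4)] by simp
    ultimately show ?thesis
      using noncrossingD[OF valid_noncrossing[OF assms(1)], of C ?L x y z "psize \<sigma>"] h L
        valid_disjoint[OF assms(1), of C ?L "psize \<sigma>"] by (cases "z = psize \<sigma>") auto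
  qed
  ultimately show ?thesis using insert_last_valid[OF \<rho>(1), of ?L] unfolding eq \<rho>(2) by simp
qed

text \<open>The explicit list of blocks behind the computations with a composite below:
  decomposition, reconstruction, and the nonnested and nonaligned blocks.\<close>

lemma triple_eq:
  assumes "valid \<sigma>" "valid \<tau>" "valid \<upsilon>"
  shows "\<sigma> \<uplus> \<tau> \<star> \<upsilon> =
    insert ((\<lambda>x. x + psize \<sigma>) ` insert (psize \<tau> + psize \<upsilon> + 1) (lastblock \<tau>))
      (\<sigma> \<union> shift (psize \<sigma>) (\<tau> - {lastblock \<tau>}) \<union> shift (psize \<sigma> + psize \<tau>) \<upsilon>)"
  unfolding juxt_eq star_eq[OF assms(2,3)] shift_insert shift_Un shift_shift
  by (simp only: Un_insert_right Un_assoc add.commute[of "psize \<tau>" "psize \<sigma>"])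

lemma valid_triple:
  assumes "valid \<sigma>" "valid \<tau>" "valid \<upsilon>"
  shows "valid (\<sigma> \<uplus> \<tau> \<star> \<upsilon>) \<and> psize (\<sigma> \<uplus> \<tau> \<star> \<upsilon>) = psize \<sigma> + psize \<tau> + psize \<upsilon> + 1"
  using valid_juxt[OF assms(1), of "\<tau> \<star> \<upsilon>"] valid_star[OF assms(2,3)] by simp

section \<open>Existence and uniqueness of the decompositions\<close>

lemma restr_Un: "restr (\<sigma> \<union> \<tau>) S = restr \<sigma> S \<union> restr \<tau> S"
  unfolding restr_def by auto

lemma restr_outside: "(\<And>B. B \<in> \<pi> \<Longrightarrow> B \<inter> S = {}) \<Longrightarrow> restr \<pi> S = {}"
  unfolding restr_def by auto

lemma restr_insert: "restr (insert B \<pi>) S = restr {B} S \<union> restr \<pi> S"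
  using restr_Un[of "{B}" \<pi>] by simp

lemma restr_insert_outside: "x \<notin> S \<Longrightarrow> restr {insert x B} S = restr {B} S"
  unfolding restr_def by simp

text \<open>The rank of \<open>x + p\<close> among \<open>p + 1, p + 2, ...\<close> is
  \<open>x\<close>, so the relabelling in \<open>restr\<close> undoes the shift.\<close>

lemma restr_shift:
  assumes "valid \<rho>"
  shows "restr (shift p \<rho>) {p + 1..<p + psize \<rho> + 1} = \<rho>"
proof -
  let ?S = "{p + 1..<p + psize \<rho> + 1}"
  have "(\<lambda>s. card {t \<in> ?S. t \<le> s}) ` ((\<lambda>x. x + p) ` B \<inter> ?S) = B" if "B \<in> \<rho>" for B
  proof -
    have "(\<lambda>x. x + p) ` B \<inter> ?S = (\<lambda>x. x + p) ` B"
      using valid_bounds[OF assms that] by fastforce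
    moreover have "card {t \<in> ?S. t \<le> x + p} = x" if "x \<in> B" for x
    proof -
      have "{t \<in> ?S. t \<le> x + p} = {p + 1..p + x}"
        using valid_bounds[OF assms \<open>B \<in> \<rho>\<close> that] by auto
      then show ?thesis by simp
    qed
    ultimately show ?thesis by (simp add: image_image)
  qed
  then have "(\<lambda>B. (\<lambda>s. card {t \<in> ?S. t \<le> s}) ` (B \<inter> ?S)) ` shift p \<rho> = \<rho>"
    unfolding shift_def by (simp add: image_image)
  moreover have "{} \<notin> \<rho>" using valid_nonempty[OF assms] by blast
  ultimately show ?thesis unfolding restr_def by simp
qed

text \<open>Connectedness of \<open>\<tau>\<close> makes \<open>psize \<sigma> + 1\<close> the
  minimum of the block of the largest element \<open>n\<close>, and the last element of
  \<open>\<tau>\<close> makes \<open>psize \<sigma> + psize \<tau>\<close> its second largest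
  element. Hence the definition cuts exactly between the three parts. The block of \<open>n\<close>
  is no singleton because it contains this minimum.\<close>

lemma
  assumes v: "valid \<sigma>" "valid \<tau>" "valid \<upsilon>" and \<tau>: "\<tau> \<noteq> {}" "conn_or_empty \<tau>"
  shows triple_last_not_singleton: "{psize (\<sigma> \<uplus> \<tau> \<star> \<upsilon>)} \<notin> \<sigma> \<uplus> \<tau> \<star> \<upsilon>"
    and decomp_nonsingleton_triple: "decomp_nonsingleton (\<sigma> \<uplus> \<tau> \<star> \<upsilon>) = (\<sigma>, \<tau>, \<upsilon>)"
proof -
  let ?\<pi> = "\<sigma> \<uplus> \<tau> \<star> \<upsilon>" and ?s = "psize \<sigma>" and ?t = "psize \<tau>" and ?u = "psize \<upsilon>"
  define n where "n = ?s + ?t + ?u + 1"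
  define L where "L = (\<lambda>x. x + ?s) ` lastblock \<tau>"
  define B where "B = insert n L"
  have \<pi>: "valid ?\<pi>" "psize ?\<pi> = n" using valid_triple[OF v] by (auto simp: n_def)
  have eq: "?\<pi> = insert B (\<sigma> \<union> shift ?s (\<tau> - {lastblock \<tau>}) \<union> shift (?s + ?t) \<upsilon>)"
    unfolding triple_eq[OF v] B_def L_def n_def by (simp add: ac_simps)
  have "1 \<in> lastblock \<tau>" using \<tau> by (simp add: conn_or_empty_def)
  then have 1: "?s + 1 \<in> L" unfolding L_def by force
  have t: "lastblock \<tau> \<in> \<tau>" "?t \<in> lastblock \<tau>" using lastblock_in[OF v(2) \<tau>(1)] by auto
  have L: "?s + 1 \<le> x \<and> x \<le> ?s + ?t" if "x \<in> L" for x
    using that lastblock_bounds[OF v(2)] unfolding L_def by force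
  have tL: "?s + ?t \<in> L" using t(2) unfolding L_def by force
  have fin: "finite L"
    using valid_finite_block[OF v(2) t(1)] unfolding L_def by simp
  have B: "B \<in> ?\<pi>" "n \<in> B" unfolding eq B_def by auto
  have the: "(THE B. B \<in> ?\<pi> \<and> n \<in> B) = B"
  proof (rule the_equality)
    show "C = B" if "C \<in> ?\<pi> \<and> n \<in> C" for C
      by (rule valid_disjoint[OF \<pi>(1) _ B(1) _ B(2)]) (use that in simp_all)
  qed (use B in simp)
  show "{psize ?\<pi>} \<notin> ?\<pi>"
  proof
    assume "{psize ?\<pi>} \<in> ?\<pi>"
    then have "B = {n}" using valid_disjoint[OF \<pi>(1) B(1), of "{n}" n] B \<pi> by auto
    then show False using 1 L[OF 1] unfolding B_def n_def by auto
  qed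
  have min: "Min B = ?s + 1"
    unfolding B_def by (rule Min_eqI) (use fin 1 L n_def in auto)
  have "B - {n} = L" using L unfolding B_def n_def by force
  then have max: "Max (B - {n}) = ?s + ?t"
    using Max_eqI[OF fin _ tL] L by simp
  have out: "C \<inter> {i..<j} = {}" if "\<And>x. x \<in> C \<Longrightarrow> x < i \<or> j \<le> x" for i j and C :: "nat set"
    using that by force
  note bs = valid_bounds[OF v(1)] and bt = valid_bounds[OF v(2)] and bu = valid_bounds[OF v(3)]
  have st: "?s + 1 \<le> x \<and> x \<le> ?s + ?t" if "C \<in> shift ?s (\<tau> - {lastblock \<tau>})" "x \<in> C" for C x
    using that bt unfolding shift_def by fastforce
  have su: "?s + ?t + 1 \<le> x \<and> x < n" if "C \<in> shift (?s + ?t) \<upsilon>" "x \<in> C" for C x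
    using that bu unfolding shift_def n_def by fastforce
  have parts: "restr ?\<pi> S = restr {B} S \<union>
      (restr \<sigma> S \<union> restr (shift ?s (\<tau> - {lastblock \<tau>})) S \<union> restr (shift (?s + ?t) \<upsilon>) S)" for S
    by (subst eq, subst restr_insert) (simp only: restr_Un)
  have "restr ?\<pi> {1..<?s + 1} = restr \<sigma> {1..<?s + 1}"
  proof -
    have "restr {B} {1..<?s + 1} = {}"
      by (rule restr_outside, rule out) (use L B_def n_def in force)
    moreover have "restr (shift ?s (\<tau> - {lastblock \<tau>})) {1..<?s + 1} = {}"
      by (rule restr_outside, rule out) (use st in force)
    moreover have "restr (shift (?s + ?t) \<upsilon>) {1..<?s + 1} = {}"
      by (rule restr_outside, rule out) (use su in force)
    ultimately show ?thesis by (simp only: parts) simp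
  qed
  then have r1: "restr ?\<pi> {1..<?s + 1} = \<sigma>" using restr_shift[OF v(1), of 0] by simp
  have "restr ?\<pi> {?s + 1..<?s + ?t + 1} = restr (shift ?s \<tau>) {?s + 1..<?s + ?t + 1}"
  proof -
    have "restr \<sigma> {?s + 1..<?s + ?t + 1} = {}"
      by (rule restr_outside, rule out) (use bs in force)
    moreover have "restr (shift (?s + ?t) \<upsilon>) {?s + 1..<?s + ?t + 1} = {}"
      by (rule restr_outside, rule out) (use su in force)
    moreover have "restr (shift ?s \<tau>) S = restr {L} S \<union> restr (shift ?s (\<tau> - {lastblock \<tau>})) S" for S
    proof -
      have "shift ?s \<tau> = {L} \<union> shift ?s (\<tau> - {lastblock \<tau>})"
        using t unfolding L_def shift_def by blast
      then show ?thesis by (simp only: restr_Un)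
    qed
    \<comment> \<open>Within the middle interval the block of \<open>n\<close> is only the shifted
      last block of \<open>\<tau>\<close>, which is what completes
      \<open>\<tau> - {lastblock \<tau>}\<close> to \<open>\<tau>\<close>.\<close>
    moreover have "restr {B} {?s + 1..<?s + ?t + 1} = restr {L} {?s + 1..<?s + ?t + 1}"
      unfolding B_def by (rule restr_insert_outside) (simp add: n_def)
    ultimately show ?thesis by (simp only: parts) simp
  qed
  then have r2: "restr ?\<pi> {?s + 1..?s + ?t} = \<tau>"
    using restr_shift[OF v(2), of ?s] by (simp add: atLeastLessThanSuc_atLeastAtMost)
  have "restr ?\<pi> {?s + ?t + 1..<n} = restr (shift (?s + ?t) \<upsilon>) {?s + ?t + 1..<n}"
  proof -
    have "restr {B} {?s + ?t + 1..<n} = {}"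
      by (rule restr_outside, rule out) (use L B_def n_def in force)
    moreover have "restr (shift ?s (\<tau> - {lastblock \<tau>})) {?s + ?t + 1..<n} = {}"
      by (rule restr_outside, rule out) (use st in force)
    moreover have "restr \<sigma> {?s + ?t + 1..<n} = {}"
      by (rule restr_outside, rule out) (use bs in force)
    ultimately show ?thesis by (simp only: parts) simp
  qed
  then have r3: "restr ?\<pi> {?s + ?t + 1..<n} = \<upsilon>"
    using restr_shift[OF v(3), of "?s + ?t"] unfolding n_def by simp
  show "decomp_nonsingleton ?\<pi> = (\<sigma>, \<tau>, \<upsilon>)"
    unfolding decomp_nonsingleton_def Let_def \<pi>(2) the min max r1 r2 r3 ..
qed

section \<open>Existence: splitting at the block of the largest element\<close>

lemma slice:
  assumes ne: "{} \<notin> X" and X: "\<Union>X = {p + 1..<p + m + 1}" and dis: "disjoint X"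
    and nc: "noncrossing X"
  obtains \<rho> where "valid \<rho>" "psize \<rho> = m" "shift p \<rho> = X"
proof -
  \<comment> \<open>As a preimage under the shift, the family inherits its properties from
    \<open>X\<close>. Subtraction of \<open>p\<close> enters only to show that every block of
    \<open>X\<close> is reached.\<close>
  define \<rho> where "\<rho> = {B. (\<lambda>x. x + p) ` B \<in> X}"
  have X_bounds: "p + 1 \<le> x \<and> x < p + m + 1" if "C \<in> X" "x \<in> C" for C x
    using X that by fastforce
  have shift: "shift p \<rho> = X"
  proof
    show "shift p \<rho> \<subseteq> X" unfolding shift_def \<rho>_def by blast
    show "X \<subseteq> shift p \<rho>"
    proof
      fix C assume C: "C \<in> X"
      have "x - p + p = x" if "x \<in> C" for x using X_bounds[OF C that] by simp
      then have "(\<lambda>x. x + p) ` (\<lambda>x. x - p) ` C = C" by (simp add: image_image)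
      then show "C \<in> shift p \<rho>" using C unfolding shift_def \<rho>_def by (metis (mono_tags) image_eqI mem_Collect_eq)
    qed
  qed
  have "valid \<rho> \<and> psize \<rho> = m"
  proof (rule validI)
    fix B C :: "nat set" and x :: nat
    {
      assume "B \<in> \<rho>"
      then have B: "(\<lambda>x. x + p) ` B \<in> X" by (simp add: \<rho>_def)
      have "1 \<le> x \<and> x \<le> m" if "x \<in> B" for x using X_bounds[OF B, of "x + p"] that by simp
      then show "B \<noteq> {} \<and> B \<subseteq> {1..m}" using ne B by auto
    next
      assume "1 \<le> x" "x \<le> m"
      then have "x + p \<in> \<Union>X" unfolding X by simp
      then obtain C where "C \<in> \<rho>" "x + p \<in> (\<lambda>x. x + p) ` C"
        unfolding shift[symmetric] shift_def by blast
      then show "\<exists>B\<in>\<rho>. x \<in> B" by auto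
    next
      assume h: "B \<in> \<rho>" "C \<in> \<rho>" "x \<in> B" "x \<in> C"
      then have "x + p \<in> (\<lambda>x. x + p) ` B \<inter> (\<lambda>x. x + p) ` C" by blast
      then have "(\<lambda>x. x + p) ` B = (\<lambda>x. x + p) ` C"
        using disjointD[OF dis, of "(\<lambda>x. x + p) ` B" "(\<lambda>x. x + p) ` C"] h(1,2)
        unfolding \<rho>_def mem_Collect_eq by (metis empty_iff)
      then show "B = C" by (simp add: inj_image_eq_iff)
    }
    show "noncrossing \<rho>" unfolding noncrossing_def
    proof (intro ballI impI)
      fix B C a b c d
      assume h: "B \<in> \<rho>" "C \<in> \<rho>" "a \<in> B" "b \<in> C" "c \<in> B" "d \<in> C" "a < b" "b < c" "c < d"
      have "(\<lambda>x. x + p) ` B = (\<lambda>x. x + p) ` C"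
        by (rule noncrossingD[OF nc, of _ _ "a + p" "b + p" "c + p" "d + p"])
          (use h in \<open>auto simp: \<rho>_def\<close>)
      then show "B = C" by (simp add: inj_image_eq_iff)
    qed
  qed
  then show ?thesis using shift that by blast
qed

lemma valid_disjoint_subset: "valid \<pi> \<Longrightarrow> X \<subseteq> \<pi> \<Longrightarrow> disjoint X"
  unfolding valid_def partition_on_def using pairwise_subset by blast

lemma noncrossing_subset: "noncrossing \<pi> \<Longrightarrow> X \<subseteq> \<pi> \<Longrightarrow> noncrossing X"
  unfolding noncrossing_def by (meson subsetD)

text \<open>The rest may stand to the left of the singleton or under the star with an empty first
  factor. These are the conventions of \<open>decomp1\<close> and \<open>decomp2\<close>.\<close>

lemma remove_last_singleton:
  assumes \<pi>: "valid \<pi>" and n: "{psize \<pi>} \<in> \<pi>"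
  obtains \<rho> where "valid \<rho>" "\<pi> = \<rho> \<uplus> {} \<star> {}" "\<pi> = {} \<uplus> {} \<star> \<rho>"
proof -
  define n where "n = psize \<pi>"
  define X where "X = \<pi> - {{n}}"
  have n1: "1 \<le> n" using valid_bounds[OF \<pi> n] n_def by simp
  have "n \<notin> B" if "B \<in> X" for B
    using that valid_disjoint[OF \<pi> n, of B n] unfolding X_def n_def by auto
  moreover have "x \<in> \<Union>X" if x: "1 \<le> x" "x < n" for x
  proof -
    obtain B where "B \<in> \<pi>" "x \<in> B" using valid_cover[OF \<pi>, of x] x n_def by auto
    then show ?thesis using x unfolding X_def by auto
  qed
  moreover have "1 \<le> x \<and> x \<le> n" if "B \<in> X" "x \<in> B" for B x
    using valid_bounds[OF \<pi>, of B x] that unfolding X_def n_def by simp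
  \<comment> \<open>The bounds stay unsimplified in order to match the pattern of
    \<open>slice\<close>, here with \<open>p = 0\<close>.\<close>
  ultimately have "\<Union>X = {0 + 1..<0 + (n - 1) + 1}" using n1 by (force simp: order.strict_iff_order)
  then obtain \<rho> where \<rho>: "valid \<rho>" "psize \<rho> = n - 1" "shift 0 \<rho> = X"
  proof (rule slice[rotated])
    show "{} \<notin> X" using valid_nonempty[OF \<pi>] unfolding X_def by blast
    show "disjoint X" by (rule valid_disjoint_subset[OF \<pi>]) (auto simp: X_def)
    show "noncrossing X" by (rule noncrossing_subset[OF valid_noncrossing[OF \<pi>]]) (auto simp: X_def)
  qed
  have "\<pi> = insert {n} X" using n unfolding X_def n_def by auto
  then have eq: "\<pi> = insert {n} \<rho>" using \<rho> by simp
  have "\<rho> \<uplus> {} \<star> {} = insert {n} \<rho>"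
    unfolding triple_eq[OF \<rho>(1) valid_empty valid_empty] using \<rho>(2) n1 by simp
  moreover have "{} \<uplus> {} \<star> \<rho> = insert {n} \<rho>"
    unfolding triple_eq[OF valid_empty valid_empty \<rho>(1)] using \<rho>(2) n1 by simp
  ultimately show ?thesis using that \<rho>(1) eq by simp
qed

text \<open>The block \<open>B\<close> of \<open>n\<close>, with minimum \<open>a\<close> and second
  largest element \<open>b\<close>, separates the other blocks into those below \<open>a\<close>,
  those between \<open>a\<close> and \<open>b\<close>, and those between \<open>b\<close> and
  \<open>n\<close>. They give \<sigma>, \<tau> and \<upsilon>; the remainder of \<open>B\<close>
  without \<open>n\<close> is the block that makes \<tau> connected.\<close>

lemma triple_exists:
  assumes \<pi>: "valid \<pi>" "\<pi> \<noteq> {}" and n: "{psize \<pi>} \<notin> \<pi>"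
  obtains \<sigma> \<tau> \<upsilon> where "valid \<sigma>" "valid \<tau>" "valid \<upsilon>" "\<tau> \<noteq> {}" "conn_or_empty \<tau>" "\<pi> = \<sigma> \<uplus> \<tau> \<star> \<upsilon>"
proof -
  define n where "n = psize \<pi>"
  define B where "B = lastblock \<pi>"
  have B: "B \<in> \<pi>" "n \<in> B" using lastblock_in[OF \<pi>] by (auto simp: B_def n_def)
  note bounds = valid_bounds[OF \<pi>(1), folded n_def]
  note crossing = noncrossingD[OF valid_noncrossing[OF \<pi>(1)]]
  have fin: "finite B" using valid_finite_block[OF \<pi>(1) B(1)] .
  have notin: "x \<notin> B" if "C \<in> \<pi>" "C \<noteq> B" "x \<in> C" for C x
    using valid_disjoint[OF \<pi>(1) that(1) B(1) that(3)] that(2) by blast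
  define D where "D = B - {n}"
  have "B \<noteq> {n}" using B n unfolding n_def by blast
  then have D: "finite D" "D \<noteq> {}" using fin B unfolding D_def by auto
  define a where "a = Min D"
  define b where "b = Max D"
  have ab: "a \<in> D" "b \<in> D" using D by (auto simp: a_def b_def)
  have Dab: "a \<le> x \<and> x \<le> b" if "x \<in> D" for x using D that by (auto simp: a_def b_def)
  have bn: "b < n" using ab bounds[OF B(1), of b] unfolding D_def by auto
  have a1: "1 \<le> a" using ab bounds[OF B(1), of a] unfolding D_def by auto
  have "a \<le> b" using Dab ab by blast
  \<comment> \<open>A block with elements on both sides of \<open>a\<close> would cross
    \<open>B\<close> at \<open>a\<close> and \<open>n\<close>; one with elements between
    \<open>a\<close> and \<open>b\<close> and beyond \<open>b\<close> would cross it at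
    \<open>a\<close> and \<open>b\<close>.\<close>
  have trich: "(\<forall>x\<in>C. x < a) \<or> (\<forall>x\<in>C. a \<le> x \<and> x \<le> b) \<or> (\<forall>x\<in>C. b < x \<and> x < n)"
    if C: "C \<in> \<pi>" "C \<noteq> B" for C
  proof -
    have *: "x < n \<and> x \<noteq> a \<and> x \<noteq> b" if "x \<in> C" for x
      using notin[OF C that] bounds[OF C(1) that] B ab unfolding D_def by (auto simp: order.strict_iff_order)
    have 1: False if "x \<in> C" "y \<in> C" "x < a" "a < y" for x y
      using crossing[of C B x a y n] C B that ab *[OF that(2)] unfolding D_def by auto
    have 2: False if "x \<in> C" "y \<in> C" "a < x" "x < b" "b < y" for x y
      using crossing[of B C a x b y] C B that ab unfolding D_def by auto
    show ?thesis
    proof (cases "\<exists>x\<in>C. x < a")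
      case True
      then show ?thesis using 1 * by (metis linorder_neqE_nat)
    next
      case False
      then have ge: "a < x" if "x \<in> C" for x using that *[OF that] by (meson linorder_neqE_nat)
      show ?thesis
      proof (cases "\<exists>x\<in>C. x < b")
        case True
        then have "\<forall>x\<in>C. a \<le> x \<and> x \<le> b" using 2 ge by (metis leI less_imp_le)
        then show ?thesis by blast
      next
        case False
        then have "\<forall>x\<in>C. b < x \<and> x < n" using * by (meson linorder_neqE_nat)
        then show ?thesis by blast
      qed
    qed
  qed
  define X where "X = {C \<in> \<pi>. C \<noteq> B \<and> (\<forall>x\<in>C. x < a)}"
  define Y where "Y = {C \<in> \<pi>. C \<noteq> B \<and> (\<forall>x\<in>C. a \<le> x \<and> x \<le> b)}"
  define Z where "Z = {C \<in> \<pi>. C \<noteq> B \<and> (\<forall>x\<in>C. b < x \<and> x < n)}"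
  have "\<pi> = insert B {C \<in> \<pi>. C \<noteq> B}" using B by blast
  also have "{C \<in> \<pi>. C \<noteq> B} = X \<union> Y \<union> Z" unfolding X_def Y_def Z_def using trich by blast
  finally have \<pi>_eq: "\<pi> = insert B (X \<union> Y \<union> Z)" .
  have cover: "\<exists>C\<in>\<pi>. x \<in> C" if "1 \<le> x" "x \<le> n" for x
    using valid_cover[OF \<pi>(1)] that n_def by simp
  have ne: "{} \<notin> \<pi>" using valid_nonempty[OF \<pi>(1)] by blast
  have Bab: "x = n \<or> a \<le> x \<and> x \<le> b" if "x \<in> B" for x using Dab[of x] that unfolding D_def by auto
  have "\<Union>X = {0 + 1..<0 + (a - 1) + 1}"
  proof (intro subset_antisym subsetI)
    fix x assume "x \<in> {0 + 1..<0 + (a - 1) + 1}"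
    then have x: "1 \<le> x" "x < a" by auto
    then obtain C where C: "C \<in> \<pi>" "x \<in> C" using cover[of x] \<open>a \<le> b\<close> bn by auto
    have "C \<noteq> B" using C Bab[of x] x \<open>a \<le> b\<close> bn by auto
    have "\<not> (\<forall>x\<in>C. b < x \<and> x < n)" "\<not> (\<forall>x\<in>C. a \<le> x \<and> x \<le> b)"
      using C(2) x \<open>a \<le> b\<close> by (meson leD less_trans order_le_less_trans)+
    then have "C \<in> X" using trich[OF C(1) \<open>C \<noteq> B\<close>] C(1) \<open>C \<noteq> B\<close> unfolding X_def by blast
    then show "x \<in> \<Union>X" using C by blast
  next
    fix x assume "x \<in> \<Union>X"
    then obtain C where "C \<in> \<pi>" "x \<in> C" "x < a" unfolding X_def by blast
    then show "x \<in> {0 + 1..<0 + (a - 1) + 1}" using bounds[of C x] by simp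
  qed
  then obtain \<sigma> where \<sigma>: "valid \<sigma>" "psize \<sigma> = a - 1" "shift 0 \<sigma> = X"
  proof (rule slice[rotated])
    show "{} \<notin> X" using ne unfolding X_def by blast
    show "disjoint X" by (rule valid_disjoint_subset[OF \<pi>(1)]) (auto simp: X_def)
    show "noncrossing X" by (rule noncrossing_subset[OF valid_noncrossing[OF \<pi>(1)]]) (auto simp: X_def)
  qed
  have "\<Union>Z = {b + 1..<b + (n - 1 - b) + 1}"
  proof (intro subset_antisym subsetI)
    fix x assume "x \<in> {b + 1..<b + (n - 1 - b) + 1}"
    then have x: "b < x" "x < n" using bn by auto
    then obtain C where C: "C \<in> \<pi>" "x \<in> C" using cover[of x] by auto
    have "C \<noteq> B" using C Bab[of x] x by auto
    have "\<not> (\<forall>x\<in>C. x < a)" "\<not> (\<forall>x\<in>C. a \<le> x \<and> x \<le> b)"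
      using C(2) x \<open>a \<le> b\<close> by (meson leD less_trans order_le_less_trans)+
    then have "C \<in> Z" using trich[OF C(1) \<open>C \<noteq> B\<close>] C(1) \<open>C \<noteq> B\<close> unfolding Z_def by blast
    then show "x \<in> \<Union>Z" using C by blast
  next
    fix x assume "x \<in> \<Union>Z"
    then obtain C where "b < x" "x < n" unfolding Z_def by blast
    then show "x \<in> {b + 1..<b + (n - 1 - b) + 1}" by simp
  qed
  then obtain \<upsilon> where \<upsilon>: "valid \<upsilon>" "psize \<upsilon> = n - 1 - b" "shift b \<upsilon> = Z"
  proof (rule slice[rotated])
    show "{} \<notin> Z" using ne unfolding Z_def by blast
    show "disjoint Z" by (rule valid_disjoint_subset[OF \<pi>(1)]) (auto simp: Z_def)
    show "noncrossing Z" by (rule noncrossing_subset[OF valid_noncrossing[OF \<pi>(1)]]) (auto simp: Z_def)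
  qed
  have Y: "C \<in> \<pi>" "C \<noteq> B" if "C \<in> Y" for C using that by (auto simp: Y_def)
  have "\<Union>(insert D Y) = {a - 1 + 1..<a - 1 + (b + 1 - a) + 1}"
  proof (intro subset_antisym subsetI)
    fix x assume "x \<in> {a - 1 + 1..<a - 1 + (b + 1 - a) + 1}"
    then have x: "a \<le> x" "x \<le> b" using a1 \<open>a \<le> b\<close> by auto
    then obtain C where C: "C \<in> \<pi>" "x \<in> C" using cover[of x] bn a1 by auto
    show "x \<in> \<Union>(insert D Y)"
    proof (cases "C = B")
      case True
      then show ?thesis using C x bn unfolding D_def by auto
    next
      case False
      have "\<not> (\<forall>x\<in>C. x < a)" "\<not> (\<forall>x\<in>C. b < x \<and> x < n)"
        using C(2) x by (meson leD)+
      then have "C \<in> Y" using trich[OF C(1) False] C(1) False unfolding Y_def by blast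
      then show ?thesis using C by blast
    qed
  next
    fix x assume "x \<in> \<Union>(insert D Y)"
    then have "a \<le> x \<and> x \<le> b" using Dab unfolding Y_def by blast
    then show "x \<in> {a - 1 + 1..<a - 1 + (b + 1 - a) + 1}" using a1 by simp
  qed
  then obtain \<tau> where \<tau>: "valid \<tau>" "psize \<tau> = b + 1 - a" "shift (a - 1) \<tau> = insert D Y"
  proof (rule slice[rotated])
    show "{} \<notin> insert D Y" using D ne Y(1) by auto
    have "D \<inter> C = {}" if "C \<in> Y" for C using notin[OF Y[OF that]] unfolding D_def by blast
    moreover have "disjoint Y" by (rule valid_disjoint_subset[OF \<pi>(1)]) (auto simp: Y_def)
    ultimately show "disjoint (insert D Y)" unfolding disjoint_def by blast
    show "noncrossing (insert D Y)" unfolding noncrossing_def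
    proof (intro ballI impI)
      fix P Q w x y z
      assume h: "P \<in> insert D Y" "Q \<in> insert D Y" "w \<in> P" "x \<in> Q" "y \<in> P" "z \<in> Q" "w < x" "x < y" "y < z"
      \<comment> \<open>Returning \<open>n\<close> to \<open>D\<close> embeds the family into
        \<open>\<pi>\<close> and keeps distinct blocks distinct, so a crossing would persist in
        \<open>\<pi>\<close>.\<close>
      have lift: "\<exists>E\<in>\<pi>. R \<subseteq> E \<and> (R = D \<and> E = B \<or> R = E \<and> E \<noteq> B)" if "R \<in> insert D Y" for R
        using that Y B D_def by blast
      obtain P' where P': "P' \<in> \<pi>" "P \<subseteq> P'" "P = D \<and> P' = B \<or> P = P' \<and> P' \<noteq> B"
        using lift[OF h(1)] by blast
      obtain Q' where Q': "Q' \<in> \<pi>" "Q \<subseteq> Q'" "Q = D \<and> Q' = B \<or> Q = Q' \<and> Q' \<noteq> B"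
        using lift[OF h(2)] by blast
      have "P' = Q'" by (rule crossing[of P' Q' w x y z]) (use h P' Q' in auto)
      then show "P = Q" using P'(3) Q'(3) by blast
    qed
  qed
  have "D \<in> shift (a - 1) \<tau>" using \<tau>(3) by simp
  then obtain L where L: "L \<in> \<tau>" "D = (\<lambda>x. x + (a - 1)) ` L" unfolding shift_def by blast
  have mem: "y - (a - 1) \<in> L" if "y \<in> D" for y using that unfolding L(2) by auto
  have "b + 1 - a \<in> L" "1 \<in> L" using mem[OF ab(2)] mem[OF ab(1)] a1 by auto
  then have last: "lastblock \<tau> = L" using lastblock_eq[OF \<tau>(1) L(1)] \<tau>(2) by simp
  have "conn_or_empty \<tau>" using \<open>1 \<in> L\<close> last by (simp add: conn_or_empty_def)
  moreover have "\<tau> \<noteq> {}" using L by blast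
  moreover have "\<pi> = \<sigma> \<uplus> \<tau> \<star> \<upsilon>"
  proof -
    have "D \<notin> Y"
    proof
      assume "D \<in> Y"
      then show False using notin[OF Y[of D] ab(1)] ab(1) unfolding D_def by blast
    qed
    then have "shift (a - 1) (\<tau> - {L}) = Y"
      unfolding shift_Diff \<tau>(3) using L(2) by (simp add: shift_def)
    moreover have "(\<lambda>x. x + (a - 1)) ` insert (b + 1 - a + (n - 1 - b) + 1) L = B"
      using L(2) B a1 \<open>a \<le> b\<close> bn unfolding D_def by auto
    moreover have "a - 1 + (b + 1 - a) = b" using a1 \<open>a \<le> b\<close> by simp
    ultimately show ?thesis
      unfolding triple_eq[OF \<sigma>(1) \<tau>(1) \<upsilon>(1)] \<sigma>(2) \<tau>(2) \<upsilon>(2) last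
      using \<pi>_eq \<sigma>(3) \<upsilon>(3) by simp
  qed
  ultimately show ?thesis using that \<sigma>(1) \<tau>(1) \<upsilon>(1) by blast
qed

section \<open>Iterated decompositions\<close>

text \<open>The pairs are \<open>(\<sigma>\<^sub>i, \<sigma>'\<^sub>i)\<close> or \<open>(\<tau>\<^sub>i, \<tau>'\<^sub>i)\<close>; a pair of empty partitions stands for a singleton
  block of the largest element.\<close>

definition admissible :: "nat set set \<times> nat set set \<Rightarrow> bool" where
  "admissible p \<longleftrightarrow> valid (fst p) \<and> valid (snd p) \<and> conn_or_empty (fst p) \<and> (fst p = {} \<longrightarrow> snd p = {})"

text \<open>\<open>buildL\<close> inverts the iteration of \<open>decomp\<^sub>1\<close>, \<open>buildR\<close> that of \<open>decomp\<^sub>2\<close>.\<close>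

fun buildL :: "(nat set set \<times> nat set set) list \<Rightarrow> nat set set" where
  "buildL [] = {}"
| "buildL (p # ps) = buildL ps \<uplus> fst p \<star> snd p"

fun buildR :: "(nat set set \<times> nat set set) list \<Rightarrow> nat set set" where
  "buildR [] = {}"
| "buildR (p # ps) = snd p \<uplus> fst p \<star> buildR ps"

text \<open>The common size of \<open>buildL ps\<close> and \<open>buildR ps\<close>: besides its
  two components, each pair brings one new largest element.\<close>

definition weight :: "(nat set set \<times> nat set set) list \<Rightarrow> nat" where
  "weight ps = sum_list (map (\<lambda>p. psize (fst p) + psize (snd p) + 1) ps)"

lemma admissibleD:
  assumes "admissible p"
  shows "valid (fst p)" "valid (snd p)" "conn_or_empty (fst p)" "fst p = {} \<Longrightarrow> snd p = {}"
  using assms by (auto simp: admissible_def)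

lemma admissible_empty: "admissible ({}, {})"
  by (simp add: admissible_def conn_or_empty_def)

lemma valid_buildL:
  "\<forall>p\<in>set ps. admissible p \<Longrightarrow> valid (buildL ps) \<and> psize (buildL ps) = weight ps"
proof (induction ps)
  case (Cons p ps)
  then have "admissible p" "valid (buildL ps)" "psize (buildL ps) = weight ps" by auto
  then show ?case using valid_triple[of "buildL ps" "fst p" "snd p"] admissibleD[of p]
    by (simp add: weight_def)
qed (simp add: weight_def)

lemma valid_buildR:
  "\<forall>p\<in>set ps. admissible p \<Longrightarrow> valid (buildR ps) \<and> psize (buildR ps) = weight ps"
proof (induction ps)
  case (Cons p ps)
  then have "admissible p" "valid (buildR ps)" "psize (buildR ps) = weight ps" by auto
  then show ?case using valid_triple[of "snd p" "fst p" "buildR ps"] admissibleD[of p]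
    by (simp add: weight_def)
qed (simp add: weight_def)

lemma weight_0: "weight ps = 0 \<longleftrightarrow> ps = []"
  by (cases ps) (auto simp: weight_def)

lemma buildL_eq_empty: "\<forall>p\<in>set ps. admissible p \<Longrightarrow> buildL ps = {} \<longleftrightarrow> ps = []"
  using valid_buildL[of ps] valid_psize_0[of "buildL ps"] weight_0[of ps] by auto

lemma buildR_eq_empty: "\<forall>p\<in>set ps. admissible p \<Longrightarrow> buildR ps = {} \<longleftrightarrow> ps = []"
  using valid_buildR[of ps] valid_psize_0[of "buildR ps"] weight_0[of ps] by auto

lemma decomp_append_singleton:
  assumes "valid \<rho>"
  shows "decomp1 (\<rho> \<uplus> {} \<star> {}) = (\<rho>, {}, {})" "decomp2 ({} \<uplus> {} \<star> \<rho>) = ({}, {}, \<rho>)"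
proof -
  let ?n = "psize \<rho> + 1"
  have eq: "\<rho> \<uplus> {} \<star> {} = insert {?n} \<rho>" "{} \<uplus> {} \<star> \<rho> = insert {?n} \<rho>"
    using triple_eq[OF assms valid_empty valid_empty] triple_eq[OF valid_empty valid_empty assms]
    by simp_all
  have size: "psize (insert {?n} \<rho>) = ?n"
    using valid_triple[OF assms valid_empty valid_empty] unfolding eq by simp
  have "restr (insert {?n} \<rho>) {1..<?n} = restr {{?n}} {1..<?n} \<union> restr \<rho> {1..<?n}"
    by (rule restr_insert)
  also have "restr {{?n}} {1..<?n} = {}" by (rule restr_outside) auto
  also have "restr \<rho> {1..<?n} = \<rho>" using restr_shift[OF assms, of 0] by simp
  finally have "restr (insert {?n} \<rho>) {1..<?n} = \<rho>" by simp
  then show "decomp1 (\<rho> \<uplus> {} \<star> {}) = (\<rho>, {}, {})" "decomp2 ({} \<uplus> {} \<star> \<rho>) = ({}, {}, \<rho>)"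
    unfolding eq decomp1_def decomp2_def Let_def size by simp_all
qed

text \<open>The head of the list is attached last and brings the largest element, so one
  decomposition step removes exactly this pair. If its first component is empty, admissibility
  empties the second one too, and the singleton rule applies.\<close>

lemma decomp1_buildL:
  assumes "\<forall>q\<in>set (p # ps). admissible q"
  shows "decomp1 (buildL (p # ps)) = (buildL ps, fst p, snd p)"
proof (cases "fst p = {}")
  case True
  then show ?thesis using assms admissibleD(4)[of p] decomp_append_singleton(1) valid_buildL[of ps] by simp
next
  case False
  then show ?thesis
    using triple_last_not_singleton[of "buildL ps" "fst p" "snd p"]
      decomp_nonsingleton_triple[of "buildL ps" "fst p" "snd p"] valid_buildL[of ps]
      admissibleD[of p] assms
    by (simp add: decomp1_def Let_def)
qed

lemma decomp2_buildR:
  assumes "\<forall>q\<in>set (p # ps). admissible q"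
  shows "decomp2 (buildR (p # ps)) = (snd p, fst p, buildR ps)"
proof (cases "fst p = {}")
  case True
  then show ?thesis using assms admissibleD(4)[of p] decomp_append_singleton(2) valid_buildR[of ps] by simp
next
  case False
  then show ?thesis
    using triple_last_not_singleton[of "snd p" "fst p" "buildR ps"]
      decomp_nonsingleton_triple[of "snd p" "fst p" "buildR ps"] valid_buildR[of ps]
      admissibleD[of p] assms
    by (simp add: decomp2_def Let_def)
qed

lemma valid_cases:
  assumes "valid \<pi>" "\<pi> \<noteq> {}"
  obtains (singleton) \<rho> where "valid \<rho>" "\<pi> = \<rho> \<uplus> {} \<star> {}" "\<pi> = {} \<uplus> {} \<star> \<rho>"
    | (triple) \<sigma> \<tau> \<upsilon> where "valid \<sigma>" "valid \<tau>" "valid \<upsilon>" "\<tau> \<noteq> {}" "conn_or_empty \<tau>" "\<pi> = \<sigma> \<uplus> \<tau> \<star> \<upsilon>"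
  using remove_last_singleton[OF assms(1)] triple_exists[OF assms] by metis

lemma buildL_surj: "valid \<pi> \<Longrightarrow> \<exists>ps. (\<forall>p\<in>set ps. admissible p) \<and> \<pi> = buildL ps"
proof (induction "psize \<pi>" arbitrary: \<pi> rule: less_induct)
  case less
  show ?case
  proof (cases "\<pi> = {}")
    case True
    then show ?thesis by (intro exI[of _ "[]"]) simp
  next
    case False
    obtain \<sigma> p where p: "valid \<sigma>" "admissible p" "\<pi> = \<sigma> \<uplus> fst p \<star> snd p"
      using less.prems False
    proof (cases rule: valid_cases)
      case (singleton \<rho>)
      then show ?thesis using that[of \<rho> "({}, {})"] admissible_empty by simp
    next
      case (triple \<sigma> \<tau> \<upsilon>)
      then show ?thesis using that[of \<sigma> "(\<tau>, \<upsilon>)"] by (simp add: admissible_def)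
    qed
    then have "psize \<sigma> < psize \<pi>" using valid_triple[of \<sigma> "fst p" "snd p"] admissibleD[of p] by simp
    then obtain ps where "\<forall>p\<in>set ps. admissible p" "\<sigma> = buildL ps" using less.hyps p by blast
    then show ?thesis using p by (intro exI[of _ "p # ps"]) simp
  qed
qed

lemma buildR_surj: "valid \<pi> \<Longrightarrow> \<exists>ps. (\<forall>p\<in>set ps. admissible p) \<and> \<pi> = buildR ps"
proof (induction "psize \<pi>" arbitrary: \<pi> rule: less_induct)
  case less
  show ?case
  proof (cases "\<pi> = {}")
    case True
    then show ?thesis by (intro exI[of _ "[]"]) simp
  next
    case False
    obtain \<upsilon> p where p: "valid \<upsilon>" "admissible p" "\<pi> = snd p \<uplus> fst p \<star> \<upsilon>"
      using less.prems False
    proof (cases rule: valid_cases)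
      case (singleton \<rho>)
      then show ?thesis using that[of \<rho> "({}, {})"] admissible_empty by simp
    next
      case (triple \<sigma> \<tau> \<upsilon>)
      then show ?thesis using that[of \<upsilon> "(\<tau>, \<sigma>)"] by (simp add: admissible_def)
    qed
    then have "psize \<upsilon> < psize \<pi>" using valid_triple[of "snd p" "fst p" \<upsilon>] admissibleD[of p] by simp
    then obtain ps where "\<forall>p\<in>set ps. admissible p" "\<upsilon> = buildR ps" using less.hyps p by blast
    then show ?thesis using p by (intro exI[of _ "p # ps"]) simp
  qed
qed

section \<open>The sequences of the definition on built partitions\<close>

text \<open>The sequences are indexed from 1 and lists from 0, so term \<open>i + 1\<close> belongs
  to the suffix after \<open>i\<close> pairs.\<close>

lemma pi_seq_buildL:
  assumes "\<forall>p\<in>set ps. admissible p" "i \<le> length ps"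
  shows "pi_seq (buildL ps) (i + 1) = buildL (drop i ps)"
  using assms(2)
proof (induction i)
  case (Suc i)
  have d: "drop i ps = ps ! i # drop (Suc i) ps" using Suc.prems by (simp add: Cons_nth_drop_Suc)
  have "\<forall>q\<in>set (ps ! i # drop (Suc i) ps). admissible q"
    using assms(1) unfolding d[symmetric] by (meson in_set_dropD)
  from decomp1_buildL[OF this] have "fst (decomp1 (buildL (drop i ps))) = buildL (drop (Suc i) ps)"
    by (simp only: d fst_conv)
  then show ?case using Suc by (simp add: pi_seq_def)
qed (simp add: pi_seq_def)

lemma upsilon_seq_buildR:
  assumes "\<forall>p\<in>set ps. admissible p" "i \<le> length ps"
  shows "upsilon_seq (buildR ps) (i + 1) = buildR (drop i ps)"
  using assms(2)
proof (induction i)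
  case (Suc i)
  have d: "drop i ps = ps ! i # drop (Suc i) ps" using Suc.prems by (simp add: Cons_nth_drop_Suc)
  have "\<forall>q\<in>set (ps ! i # drop (Suc i) ps). admissible q"
    using assms(1) unfolding d[symmetric] by (meson in_set_dropD)
  from decomp2_buildR[OF this] have "snd (snd (decomp2 (buildR (drop i ps)))) = buildR (drop (Suc i) ps)"
    by (simp only: d snd_conv)
  then show ?case using Suc by (simp add: upsilon_seq_def)
qed (simp add: upsilon_seq_def)

text \<open>Only the empty list builds the empty partition, so the iteration stops exactly when the
  list is exhausted.\<close>

lemma r_len_buildL:
  assumes "\<forall>p\<in>set ps. admissible p"
  shows "r_len (buildL ps) = length ps"
  unfolding r_len_def
proof (rule Least_equality)
  show "pi_seq (buildL ps) (length ps + 1) = {}" using pi_seq_buildL[OF assms, of "length ps"] by simp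
  fix r assume r: "pi_seq (buildL ps) (r + 1) = {}"
  show "length ps \<le> r"
  proof (rule ccontr)
    assume "\<not> length ps \<le> r"
    then have "buildL (drop r ps) = {}" using r pi_seq_buildL[OF assms, of r] by simp
    moreover have "\<forall>p\<in>set (drop r ps). admissible p" using assms by (meson in_set_dropD)
    ultimately show False using buildL_eq_empty[of "drop r ps"] \<open>\<not> length ps \<le> r\<close> by simp
  qed
qed

lemma s_len_buildR:
  assumes "\<forall>p\<in>set ps. admissible p"
  shows "s_len (buildR ps) = length ps"
  unfolding s_len_def
proof (rule Least_equality)
  show "upsilon_seq (buildR ps) (length ps + 1) = {}"
    using upsilon_seq_buildR[OF assms, of "length ps"] by simp
  fix s assume s: "upsilon_seq (buildR ps) (s + 1) = {}"
  show "length ps \<le> s"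
  proof (rule ccontr)
    assume "\<not> length ps \<le> s"
    then have "buildR (drop s ps) = {}" using s upsilon_seq_buildR[OF assms, of s] by simp
    moreover have "\<forall>p\<in>set (drop s ps). admissible p" using assms by (meson in_set_dropD)
    ultimately show False using buildR_eq_empty[of "drop s ps"] \<open>\<not> length ps \<le> s\<close> by simp
  qed
qed

lemma sigma_seq_buildL:
  assumes "\<forall>p\<in>set ps. admissible p" "i < length ps"
  shows "sigma_seq (buildL ps) (i + 1) = fst (ps ! i)" "sigma'_seq (buildL ps) (i + 1) = snd (ps ! i)"
proof -
  have d: "drop i ps = ps ! i # drop (Suc i) ps" using assms(2) by (simp add: Cons_nth_drop_Suc)
  have "\<forall>q\<in>set (ps ! i # drop (Suc i) ps). admissible q"
    using assms(1) unfolding d[symmetric] by (meson in_set_dropD)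
  then have "decomp1 (pi_seq (buildL ps) (i + 1)) = (buildL (drop (Suc i) ps), fst (ps ! i), snd (ps ! i))"
    using pi_seq_buildL[OF assms(1), of i] assms(2) decomp1_buildL unfolding d by simp
  then show "sigma_seq (buildL ps) (i + 1) = fst (ps ! i)" "sigma'_seq (buildL ps) (i + 1) = snd (ps ! i)"
    by (simp_all add: sigma_seq_def sigma'_seq_def)
qed

lemma tau_seq_buildR:
  assumes "\<forall>p\<in>set ps. admissible p" "i < length ps"
  shows "tau_seq (buildR ps) (i + 1) = fst (ps ! i)" "tau'_seq (buildR ps) (i + 1) = snd (ps ! i)"
proof -
  have d: "drop i ps = ps ! i # drop (Suc i) ps" using assms(2) by (simp add: Cons_nth_drop_Suc)
  have "\<forall>q\<in>set (ps ! i # drop (Suc i) ps). admissible q"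
    using assms(1) unfolding d[symmetric] by (meson in_set_dropD)
  then have "decomp2 (upsilon_seq (buildR ps) (i + 1)) = (snd (ps ! i), fst (ps ! i), buildR (drop (Suc i) ps))"
    using upsilon_seq_buildR[OF assms(1), of i] assms(2) decomp2_buildR unfolding d by simp
  then show "tau_seq (buildR ps) (i + 1) = fst (ps ! i)" "tau'_seq (buildR ps) (i + 1) = snd (ps ! i)"
    by (simp_all add: tau_seq_def tau'_seq_def)
qed

section \<open>The involution\<close>

lemma buildR_foldr: "buildR ps = foldr (\<lambda>p M. snd p \<uplus> fst p \<star> M) ps {}"
  by (induction ps) simp_all

text \<open>Translates the index range from 2 upwards in the definition of \<xi> into the tail of
  the list; the first pair is treated separately there.\<close>

lemma tl_eq_map_nth: "tl ps = map (\<lambda>j. ps ! (j - 1)) [2..<length ps + 1]"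
  by (rule nth_equalityI) (auto simp: nth_tl simp del: upt_Suc)

text \<open>The recursion for the \<open>M_i\<close> is that of \<open>buildR\<close>, but it runs
  on the pairs found by \<open>decomp1\<close>. At this point a left list is reread as a right
  list.\<close>

lemma M_part_buildL:
  assumes "\<forall>p\<in>set ps. admissible p"
  shows "M_part (buildL ps) 2 = buildR (tl ps)"
proof -
  have "sigma_seq (buildL ps) j = fst (ps ! (j - 1)) \<and> sigma'_seq (buildL ps) j = snd (ps ! (j - 1))"
    if "j \<in> set [2..<length ps + 1]" for j
  proof -
    have "j - 1 < length ps" "j - 1 + 1 = j" using that by auto
    then show ?thesis using sigma_seq_buildL[OF assms, of "j - 1"] by metis
  qed
  then show ?thesis
    unfolding M_part_def r_len_buildL[OF assms] buildR_foldr tl_eq_map_nth foldr_map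
    by (intro foldr_cong) simp_all
qed

text \<open>The opposite rereading. The descending indices in \<xi> give the order in which
  \<open>buildL\<close> places its pairs, and associativity of \<open>\<uplus>\<close> accounts for
  the different bracketing.\<close>

lemma foldr_juxt_rev:
  assumes "\<forall>p\<in>set ps. admissible p" "valid x"
  shows "foldr (\<uplus>) (map (\<lambda>p. fst p \<star> snd p) (rev ps)) x = buildL ps \<uplus> x"
  using assms
proof (induction ps arbitrary: x)
  case (Cons p ps)
  then have "valid (fst p \<star> snd p)" "valid (buildL ps)"
    using valid_star[of "fst p" "snd p"] admissibleD[of p] valid_buildL[of ps] by auto
  then show ?case using Cons valid_juxt[of "fst p \<star> snd p" x] by (simp add: juxt_assoc)
qed simp

text \<open>The partition is at once \<open>buildL\<close> of \<open>?P\<close> and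
  \<open>buildR\<close> of \<open>?Q\<close>, and both lists are headed by a pair with first
  component \<open>\<sigma>\<close>. The tail \<open>ps\<close> of \<open>?P\<close> goes into the
  \<open>M\<close> part, and the tail \<open>qs\<close> of \<open>?Q\<close> into the juxtaposition
  on the left.\<close>

lemma xi_nonsingleton_build:
  assumes "\<forall>p\<in>set ps. admissible p" "\<forall>q\<in>set qs. admissible q"
    and \<sigma>: "valid \<sigma>" "conn_or_empty \<sigma>" "\<sigma> \<noteq> {}"
  shows "xi_nonsingleton (buildL ps \<uplus> \<sigma> \<star> buildR qs) = buildL qs \<uplus> \<sigma> \<star> buildR ps"
proof -
  let ?P = "(\<sigma>, buildR qs) # ps" and ?Q = "(\<sigma>, buildL ps) # qs"
  let ?\<pi> = "buildL ps \<uplus> \<sigma> \<star> buildR qs"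
  have P: "\<forall>p\<in>set ?P. admissible p" using assms valid_buildR[OF assms(2)] by (simp add: admissible_def)
  have Q: "\<forall>p\<in>set ?Q. admissible p" using assms valid_buildL[OF assms(1)] by (simp add: admissible_def)
  have \<pi>P: "?\<pi> = buildL ?P" and \<pi>Q: "?\<pi> = buildR ?Q" by simp_all
  have "sigma_seq ?\<pi> 1 = \<sigma>" using sigma_seq_buildL(1)[OF P, of 0] unfolding \<pi>P by simp
  moreover have "M_part ?\<pi> 2 = buildR ps" using M_part_buildL[OF P] unfolding \<pi>P by simp
  moreover have "map (\<lambda>i. tau_seq ?\<pi> i \<star> tau'_seq ?\<pi> i) (rev [2..<s_len ?\<pi> + 1]) =
      map (\<lambda>p. fst p \<star> snd p) (rev qs)"
  proof -
    have "tau_seq ?\<pi> j = fst (?Q ! (j - 1)) \<and> tau'_seq ?\<pi> j = snd (?Q ! (j - 1))"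
      if "j \<in> set [2..<length ?Q + 1]" for j
    proof -
      have "j - 1 < length ?Q" "j - 1 + 1 = j" using that by auto
      then show ?thesis using tau_seq_buildR[OF Q, of "j - 1"] unfolding \<pi>Q by metis
    qed
    moreover have "qs = map (\<lambda>j. ?Q ! (j - 1)) [2..<length ?Q + 1]"
      using tl_eq_map_nth[of ?Q] by simp
    moreover have "s_len ?\<pi> = length ?Q" unfolding \<pi>Q using s_len_buildR[OF Q] .
    ultimately have "map (\<lambda>i. tau_seq ?\<pi> i \<star> tau'_seq ?\<pi> i) [2..<s_len ?\<pi> + 1] =
        map (\<lambda>p. fst p \<star> snd p) (map (\<lambda>j. ?Q ! (j - 1)) [2..<length ?Q + 1])"
      unfolding map_map by (intro map_cong) simp_all
    then show ?thesis unfolding rev_map[symmetric] \<open>qs = _\<close>[symmetric] by (rule arg_cong)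
  qed
  moreover have "valid (\<sigma> \<star> buildR ps)" using valid_star[OF \<sigma>(1)] valid_buildR[OF assms(1)] by blast
  ultimately show ?thesis
    unfolding xi_nonsingleton_def using foldr_juxt_rev[OF assms(2)] by simp
qed

lemma append_singleton:
  assumes "valid \<rho>"
  shows "\<rho> \<uplus> {} \<star> {} = insert {psize \<rho> + 1} \<rho>" "{} \<star> \<rho> = insert {psize \<rho> + 1} \<rho>"
  using triple_eq[OF assms valid_empty valid_empty] star_eq[OF valid_empty assms] by simp_all

text \<open>Leading empty pairs are trailing singletons in either reading, so the final singletons
  that \<xi> keeps aside fit into the same list calculus.\<close>

lemma build_replicate:
  assumes "\<forall>p\<in>set ps. admissible p"
  shows "buildL (replicate m ({}, {}) @ ps) = buildL ps \<union> (\<lambda>j. {j}) ` {weight ps + 1..weight ps + m}"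
    and "buildR (replicate m ({}, {}) @ ps) = buildR ps \<union> (\<lambda>j. {j}) ` {weight ps + 1..weight ps + m}"
proof -
  have adm: "\<forall>p\<in>set (replicate m ({}, {}) @ ps). admissible p" for m
    using assms admissible_empty by auto
  have w: "weight (replicate m ({}, {}) @ ps) = weight ps + m" for m
    by (simp add: weight_def sum_list_replicate)
  have ivl: "{weight ps + 1..weight ps + Suc m} = insert (weight ps + m + 1) {weight ps + 1..weight ps + m}" for m
    by auto
  show "buildL (replicate m ({}, {}) @ ps) = buildL ps \<union> (\<lambda>j. {j}) ` {weight ps + 1..weight ps + m}"
  proof (induction m)
    case (Suc m)
    let ?X = "buildL (replicate m ({}, {}) @ ps)"
    have "buildL (replicate (Suc m) ({}, {}) @ ps) = insert {psize ?X + 1} ?X"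
      using append_singleton(1)[of ?X] valid_buildL[OF adm[of m]] by simp
    also have "\<dots> = insert {weight ps + m + 1} (buildL ps \<union> (\<lambda>j. {j}) ` {weight ps + 1..weight ps + m})"
      using Suc.IH valid_buildL[OF adm[of m]] w[of m] by simp
    finally show ?case unfolding ivl by simp
  qed simp
  show "buildR (replicate m ({}, {}) @ ps) = buildR ps \<union> (\<lambda>j. {j}) ` {weight ps + 1..weight ps + m}"
  proof (induction m)
    case (Suc m)
    let ?X = "buildR (replicate m ({}, {}) @ ps)"
    have "buildR (replicate (Suc m) ({}, {}) @ ps) = insert {psize ?X + 1} ?X"
      using append_singleton(2)[of ?X] valid_buildR[OF adm[of m]] by simp
    also have "\<dots> = insert {weight ps + m + 1} (buildR ps \<union> (\<lambda>j. {j}) ` {weight ps + 1..weight ps + m})"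
      using Suc.IH valid_buildR[OF adm[of m]] w[of m] by simp
    finally show ?case unfolding ivl by simp
  qed simp
qed

text \<open>Both sides unfold to \<open>buildL ps \<uplus> \<sigma> \<star> buildR qs\<close>
  followed by \<open>m\<close> singletons. This links the reading that shows nonnested blocks with
  the one that shows nonaligned blocks.\<close>

lemma buildL_eq_buildR:
  assumes "\<forall>p\<in>set ps. admissible p" "\<forall>q\<in>set qs. admissible q" "valid \<sigma>" "conn_or_empty \<sigma>" "\<sigma> \<noteq> {}"
  shows "buildL (replicate m ({}, {}) @ (\<sigma>, buildR qs) # ps) =
    buildR (replicate m ({}, {}) @ (\<sigma>, buildL ps) # qs)"
proof -
  have "\<forall>p\<in>set ((\<sigma>, buildR qs) # ps). admissible p" "\<forall>p\<in>set ((\<sigma>, buildL ps) # qs). admissible p"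
    using assms valid_buildL[OF assms(1)] valid_buildR[OF assms(2)] by (auto simp: admissible_def)
  moreover have "weight ((\<sigma>, buildR qs) # ps) = weight ((\<sigma>, buildL ps) # qs)"
    using valid_buildL[OF assms(1)] valid_buildR[OF assms(2)] by (simp add: weight_def)
  ultimately show ?thesis by (simp add: build_replicate)
qed

text \<open>The size \<open>k\<close> of the core is the largest element that is not a singleton
  block: above it there are only singletons, and since \<open>\<sigma>\<close> is nonempty, the
  block of \<open>k\<close> has a further element. Restricting to \<open>{1..k}\<close> therefore
  recovers the core.\<close>

lemma xi_buildL:
  assumes "\<forall>p\<in>set ps. admissible p" "\<forall>q\<in>set qs. admissible q"
    and \<sigma>: "valid \<sigma>" "conn_or_empty \<sigma>" "\<sigma> \<noteq> {}"
  shows "xi (buildL (replicate m ({}, {}) @ (\<sigma>, buildR qs) # ps)) =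
    buildL (replicate m ({}, {}) @ (\<sigma>, buildR ps) # qs)"
proof -
  let ?P = "(\<sigma>, buildR qs) # ps" and ?Q = "(\<sigma>, buildR ps) # qs"
  let ?\<pi> = "buildL (replicate m ({}, {}) @ ?P)"
  define \<rho> where "\<rho> = buildL ps \<uplus> \<sigma> \<star> buildR qs"
  define k where "k = weight ?P"
  note L = valid_buildL[OF assms(1)] and R = valid_buildR[OF assms(2)]
  have P: "\<forall>p\<in>set ?P. admissible p" and Q: "\<forall>p\<in>set ?Q. admissible p"
    using assms R valid_buildR[OF assms(1)] by (auto simp: admissible_def)
  have k: "weight ?Q = k" using R valid_buildR[OF assms(1)] by (simp add: weight_def k_def)
  have \<rho>: "valid \<rho>" "psize \<rho> = k" using valid_buildL[OF P] by (auto simp: \<rho>_def k_def)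
  have \<pi>: "?\<pi> = \<rho> \<union> (\<lambda>j. {j}) ` {k + 1..k + m}"
    using build_replicate(1)[OF P] by (simp add: \<rho>_def k_def)
  have "\<forall>p\<in>set (replicate m ({}, {}) @ ?P). admissible p" using P admissible_empty by auto
  then have size: "psize ?\<pi> = k + m"
    using valid_buildL by (auto simp: weight_def k_def sum_list_replicate)
  have k1: "1 \<le> k" by (simp add: k_def weight_def)
  have nk: "{k} \<notin> \<rho>"
    using triple_last_not_singleton[of "buildL ps" \<sigma> "buildR qs"] L R \<sigma> \<rho>(2) by (simp add: \<rho>_def)
  let ?K = "{j \<in> {1..k + m}. {j} \<notin> ?\<pi>}"
  have kK: "k \<in> ?K" using nk k1 unfolding \<pi> by auto
  have "j \<le> k" if "j \<in> ?K" for j using that unfolding \<pi> by (auto simp: not_less_eq_eq)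
  then have max: "Max ?K = k" by (rule Max_eqI[rotated]) (use kK in simp_all)
  have ne: "?K \<noteq> {}" using kK by blast
  have "restr ?\<pi> {1..k} = restr \<rho> {1..k}"
  proof -
    have "restr ((\<lambda>j. {j}) ` {k + 1..k + m}) {1..k} = {}" by (rule restr_outside) auto
    then show ?thesis unfolding \<pi> restr_Un by simp
  qed
  then have r: "restr ?\<pi> {1..k} = \<rho>"
    using restr_shift[OF \<rho>(1), of 0] \<rho>(2) by (simp add: atLeastLessThanSuc_atLeastAtMost)
  have "xi ?\<pi> = xi_nonsingleton \<rho> \<union> (\<lambda>j. {j}) ` {k + 1..k + m}"
    unfolding xi_def Let_def size max r by (simp only: if_not_P[OF ne])
  also have "\<dots> = buildL (replicate m ({}, {}) @ ?Q)"
    unfolding \<rho>_def xi_nonsingleton_build[OF assms] build_replicate(1)[OF Q] k by simp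
  finally show ?thesis .
qed

lemma xi_singletons: "xi (buildL (replicate m ({}, {}))) = buildL (replicate m ({}, {}))"
proof -
  let ?\<pi> = "buildL (replicate m ({}, {}))"
  have "\<forall>p\<in>set (replicate m ({}, {})). admissible p" using admissible_empty by auto
  then have "psize ?\<pi> = m" using valid_buildL by (auto simp: weight_def sum_list_replicate)
  moreover have "?\<pi> = (\<lambda>j. {j}) ` {1..m}" using build_replicate(1)[of "[]" m] by (simp add: weight_def)
  ultimately have "{k \<in> {1..psize ?\<pi>}. {k} \<notin> ?\<pi>} = {}" by auto
  then show ?thesis unfolding xi_def Let_def by (simp only: simp_thms if_True)
qed

text \<open>After the leading empty pairs, the next pair has a nonempty first component by
  admissibility. Its second component is in turn expanded as a right list, which provides
  \<open>qs\<close>.\<close>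

lemma normal_form:
  assumes "valid \<pi>"
  obtains (singletons) m where "\<pi> = buildL (replicate m ({}, {}))"
    | (core) m \<sigma> ps qs where "\<forall>p\<in>set ps. admissible p" "\<forall>q\<in>set qs. admissible q"
      "valid \<sigma>" "conn_or_empty \<sigma>" "\<sigma> \<noteq> {}" "\<pi> = buildL (replicate m ({}, {}) @ (\<sigma>, buildR qs) # ps)"
proof -
  obtain Ps where Ps: "\<forall>p\<in>set Ps. admissible p" "\<pi> = buildL Ps" using buildL_surj[OF assms] by blast
  define m where "m = length (takeWhile (\<lambda>p. p = ({}, {})) Ps)"
  have "takeWhile (\<lambda>p. p = ({}, {})) Ps = replicate m ({}, {})"
    unfolding m_def by (metis (mono_tags, lifting) replicate_eqI set_takeWhileD)
  then have eq: "Ps = replicate m ({}, {}) @ dropWhile (\<lambda>p. p = ({}, {})) Ps"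
    by (metis takeWhile_dropWhile_id)
  show ?thesis
  proof (cases "dropWhile (\<lambda>p. p = ({}, {})) Ps")
    case Nil
    have "Ps = replicate m ({}, {})" using eq unfolding Nil by simp
    then show ?thesis using singletons[of m] Ps(2) by blast
  next
    case (Cons p ps)
    have "p \<noteq> ({}, {})" using Cons by (metis (mono_tags, lifting) dropWhile_eq_Cons_conv)
    have adm: "\<forall>q\<in>set (p # ps). admissible q" using Ps(1) unfolding Cons[symmetric] by (meson set_dropWhileD)
    then have p: "admissible p" by simp
    then have "fst p \<noteq> {}" using \<open>p \<noteq> ({}, {})\<close> admissibleD(4)[of p] by (metis prod.collapse)
    moreover obtain qs where "\<forall>q\<in>set qs. admissible q" "snd p = buildR qs"
      using buildR_surj[OF admissibleD(2)[OF p]] by blast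
    moreover have "\<pi> = buildL (replicate m ({}, {}) @ (fst p, snd p) # ps)" using eq Cons Ps(2) by simp
    ultimately show ?thesis using core[of ps qs "fst p" m] adm admissibleD[OF p] by simp
  qed
qed

section \<open>Block sizes\<close>

lemma ptype_shift: "ptype (shift p \<pi>) = ptype \<pi>"
proof -
  have "inj_on (\<lambda>B. (\<lambda>x. x + p) ` B) \<pi>" using inj_shift_block inj_on_subset by blast
  then have "mset_set (shift p \<pi>) = image_mset (\<lambda>B. (\<lambda>x. x + p) ` B) (mset_set \<pi>)"
    unfolding shift_def by (rule image_mset_mset_set[symmetric])
  moreover have "card ((\<lambda>x. x + p) ` B) = card B" for B by (rule card_image) simp
  ultimately show ?thesis unfolding ptype_def by (simp add: image_mset.compositionality comp_def)
qed

lemma ptype_Un: "finite \<sigma> \<Longrightarrow> finite \<tau> \<Longrightarrow> \<sigma> \<inter> \<tau> = {} \<Longrightarrow> ptype (\<sigma> \<union> \<tau>) = ptype \<sigma> + ptype \<tau>"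
  by (simp add: ptype_def mset_set_Union)

lemma finite_shift: "finite \<pi> \<Longrightarrow> finite (shift p \<pi>)"
  by (simp add: shift_def)

lemma shift_bounds: "valid \<tau> \<Longrightarrow> B \<in> shift p \<tau> \<Longrightarrow> x \<in> B \<Longrightarrow> p + 1 \<le> x \<and> x \<le> p + psize \<tau>"
  unfolding shift_def using valid_bounds[of \<tau>] by fastforce

lemma shift_nonempty: "valid \<tau> \<Longrightarrow> B \<in> shift p \<tau> \<Longrightarrow> B \<noteq> {}"
  unfolding shift_def using valid_nonempty[of \<tau>] by fastforce

lemma disjoint_shift:
  assumes "valid \<sigma>" "valid \<tau>"
  shows "\<sigma> \<inter> shift (psize \<sigma>) \<tau> = {}"
proof (rule ccontr)
  assume "\<sigma> \<inter> shift (psize \<sigma>) \<tau> \<noteq> {}"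
  then obtain B where B: "B \<in> \<sigma>" "B \<in> shift (psize \<sigma>) \<tau>" by blast
  then obtain x where "x \<in> B" using valid_nonempty[OF assms(1)] by blast
  then show False using valid_bounds[OF assms(1) B(1)] shift_bounds[OF assms(2) B(2)] by fastforce
qed

lemma ptype_juxt:
  assumes "valid \<sigma>" "valid \<tau>"
  shows "ptype (\<sigma> \<uplus> \<tau>) = ptype \<sigma> + ptype \<tau>"
  unfolding juxt_eq using assms
  by (simp add: ptype_Un ptype_shift valid_finite finite_shift disjoint_shift)

text \<open>The term \<open>\<sigma> \<star> {}\<close> carries the block of \<open>\<sigma>\<close> that is enlarged, so that both ways of
  building a partition from a list give the same sum of types.\<close>

lemma ptype_star:
  assumes "valid \<sigma>" "valid \<tau>"
  shows "ptype (\<sigma> \<star> \<tau>) = ptype (\<sigma> \<star> {}) + ptype \<tau>"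
proof -
  let ?L = "lastblock \<sigma>"
  \<comment> \<open>For empty \<open>\<sigma>\<close> the last block is \<open>{}\<close>, and
    \<open>card ?L + 1 = 1\<close> accounts for the new singleton.\<close>
  have *: "ptype (\<sigma> \<star> \<rho>) = {#card ?L + 1#} + ptype (\<sigma> - {?L}) + ptype \<rho>" if \<rho>: "valid \<rho>" for \<rho>
  proof -
    let ?n = "psize \<sigma> + psize \<rho> + 1"
    let ?R = "(\<sigma> - {?L}) \<union> shift (psize \<sigma>) \<rho>"
    have L: "?n \<notin> ?L" using lastblock_bounds[OF assms(1), of ?n] by auto
    have fin: "finite ?L"
      using valid_finite_block[OF assms(1)] lastblock_in[OF assms(1)] by (cases "\<sigma> = {}") auto
    have "?n \<notin> C" if "C \<in> ?R" for C
      using that valid_bounds[OF assms(1), of C ?n] shift_bounds[OF \<rho>, of C "psize \<sigma>" ?n] by auto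
    then have "insert ?n ?L \<notin> ?R" by blast
    moreover have R: "finite ?R" using assms(1) \<rho> by (simp add: valid_finite finite_shift)
    ultimately have "ptype (\<sigma> \<star> \<rho>) = {#card (insert ?n ?L)#} + ptype ?R"
      unfolding star_eq[OF assms(1) \<rho>] ptype_def by simp
    moreover have "ptype ?R = ptype (\<sigma> - {?L}) + ptype \<rho>"
      using disjoint_shift[OF assms(1) \<rho>] valid_finite[OF assms(1)] valid_finite[OF \<rho>]
      by (subst ptype_Un) (auto simp: finite_shift ptype_shift)
    ultimately show ?thesis using L fin by simp
  qed
  show ?thesis using *[OF assms(2)] *[OF valid_empty] by (simp add: ptype_def)
qed

lemma ptype_build:
  assumes "\<forall>p\<in>set ps. admissible p"
  shows "ptype (buildL ps) = (\<Sum>p\<leftarrow>ps. ptype (fst p \<star> {}) + ptype (snd p))"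
    and "ptype (buildR ps) = (\<Sum>p\<leftarrow>ps. ptype (fst p \<star> {}) + ptype (snd p))"
proof -
  let ?S = "\<lambda>ps. \<Sum>p\<leftarrow>ps. ptype (fst p \<star> {}) + ptype (snd p)"
  have "ptype (buildL ps) = ?S ps \<and> ptype (buildR ps) = ?S ps"
    using assms
  proof (induction ps)
    case (Cons p ps)
    have p: "valid (fst p)" "valid (snd p)" and v: "valid (buildL ps)" "valid (buildR ps)"
      using Cons.prems admissibleD[of p] valid_buildL[of ps] valid_buildR[of ps] by auto
    have "ptype (buildL (p # ps)) = ptype (buildL ps) + (ptype (fst p \<star> {}) + ptype (snd p))"
      using ptype_juxt[OF v(1), of "fst p \<star> snd p"] valid_star[OF p] ptype_star[OF p] by simp
    moreover have "ptype (buildR (p # ps)) = ptype (snd p) + (ptype (fst p \<star> {}) + ptype (buildR ps))"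
      using ptype_juxt[OF p(2), of "fst p \<star> buildR ps"] valid_star[OF p(1) v(2)]
        ptype_star[OF p(1) v(2)] by simp
    ultimately show ?case using Cons by (simp add: ac_simps)
  qed (simp add: ptype_def)
  then show "ptype (buildL ps) = ?S ps" "ptype (buildR ps) = ?S ps" by blast+
qed

section \<open>Nonnested and nonaligned blocks\<close>

text \<open>If two elements of a block \<open>C\<close> enclose \<open>B\<close>, then the edge of
  \<open>C\<close> around \<open>Min B\<close> encloses all of \<open>B\<close>, since otherwise
  \<open>B\<close> and \<open>C\<close> would cross. The case \<open>C = B\<close> is harmless: no
  element of \<open>B\<close> encloses itself.\<close>

lemma nonnested_iff:
  assumes "valid \<pi>"
  shows "B \<in> nonnested \<pi> \<longleftrightarrow> B \<in> \<pi> \<and> (\<forall>C\<in>\<pi>. \<forall>i\<in>C. \<forall>j\<in>C. \<exists>x\<in>B. \<not> (i < x \<and> x < j))"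
proof -
  have key: "(\<exists>i j. edge \<pi> i j \<and> i < Min B \<and> Max B < j) \<longleftrightarrow> (\<exists>C\<in>\<pi>. \<exists>i\<in>C. \<exists>j\<in>C. \<forall>x\<in>B. i < x \<and> x < j)"
    if B: "B \<in> \<pi>"
  proof
    assume "\<exists>i j. edge \<pi> i j \<and> i < Min B \<and> Max B < j"
    then obtain C i j where "C \<in> \<pi>" "i \<in> C" "j \<in> C" "i < Min B" "Max B < j"
      unfolding edge_def by blast
    moreover have "finite B" "B \<noteq> {}" using valid_finite_block[OF assms B] valid_nonempty[OF assms B] .
    ultimately show "\<exists>C\<in>\<pi>. \<exists>i\<in>C. \<exists>j\<in>C. \<forall>x\<in>B. i < x \<and> x < j" by (meson Max_less_iff Min_gr_iff)
  next
    assume "\<exists>C\<in>\<pi>. \<exists>i\<in>C. \<exists>j\<in>C. \<forall>x\<in>B. i < x \<and> x < j"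
    then obtain C i j where C: "C \<in> \<pi>" "i \<in> C" "j \<in> C" "\<forall>x\<in>B. i < x \<and> x < j" by blast
    note mn = valid_Min[OF assms B] and mx = valid_Max[OF assms B]
    have le: "Min B \<le> Max B" using valid_finite_block[OF assms B] mn by simp
    have "C \<noteq> B" using C by blast
    then have disj: "x \<notin> C" if "x \<in> B" for x
      using valid_disjoint[OF assms C(1) B, of x] that by blast
    have "finite C" using valid_finite_block[OF assms C(1)] .
    then obtain k l where kl: "edge \<pi> k l" "k \<in> C" "l \<in> C" "k \<le> Min B" "Min B < l"
      using edge_in_block[OF C(1-3), of "Min B"] C(4) mn less_imp_le by metis
    have "k < Min B" using kl disj[OF mn] by (metis le_neq_implies_less)
    moreover have "Max B < l"
    proof (rule ccontr)
      assume "\<not> Max B < l"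
      then have "l < Max B" using disj[OF mx] kl by (metis linorder_neqE_nat)
      then show False
        using noncrossingD[OF valid_noncrossing[OF assms] C(1) B kl(2) mn kl(3) mx] kl \<open>k < Min B\<close> \<open>C \<noteq> B\<close>
        by simp
    qed
    ultimately show "\<exists>i j. edge \<pi> i j \<and> i < Min B \<and> Max B < j" using kl(1) by blast
  qed
  show ?thesis
  proof (cases "B \<in> \<pi>")
    case True
    then show ?thesis unfolding nonnested_def mem_Collect_eq key[OF True] by (simp)
  next
    case False
    then show ?thesis by (simp add: nonnested_def)
  qed
qed

text \<open>Two elements \<open>i < j\<close> of one block beyond \<open>B\<close> yield an edge
  that starts at \<open>i\<close> or later, hence also beyond \<open>B\<close>.\<close>

lemma nonaligned_iff:
  assumes "valid \<pi>"
  shows "B \<in> nonaligned \<pi> \<longleftrightarrow> B \<in> \<pi> \<and> (\<forall>C\<in>\<pi>. \<forall>i\<in>C. \<forall>j\<in>C. i < j \<longrightarrow> (\<exists>x\<in>B. i \<le> x))"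
proof -
  have key: "(\<exists>i j. edge \<pi> i j \<and> Max B < i) \<longleftrightarrow> (\<exists>C\<in>\<pi>. \<exists>i\<in>C. \<exists>j\<in>C. i < j \<and> (\<forall>x\<in>B. x < i))"
    if B: "B \<in> \<pi>"
  proof -
    have max: "Max B < i \<longleftrightarrow> (\<forall>x\<in>B. x < i)" for i
      using valid_finite_block[OF assms B] valid_nonempty[OF assms B] by simp
    show ?thesis
    proof
      assume "\<exists>i j. edge \<pi> i j \<and> Max B < i"
      then show "\<exists>C\<in>\<pi>. \<exists>i\<in>C. \<exists>j\<in>C. i < j \<and> (\<forall>x\<in>B. x < i)"
        unfolding edge_def max by blast
    next
      assume "\<exists>C\<in>\<pi>. \<exists>i\<in>C. \<exists>j\<in>C. i < j \<and> (\<forall>x\<in>B. x < i)"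
      then obtain C i j where C: "C \<in> \<pi>" "i \<in> C" "j \<in> C" "i < j" "\<forall>x\<in>B. x < i" by blast
      obtain k l where "edge \<pi> k l" "i \<le> k"
        using edge_in_block[OF C(1-3) order_refl C(4) valid_finite_block[OF assms C(1)]] by metis
      then have "\<forall>x\<in>B. x < k" using C(5) by fastforce
      then show "\<exists>i j. edge \<pi> i j \<and> Max B < i" using \<open>edge \<pi> k l\<close> unfolding max by blast
    qed
  qed
  show ?thesis
  proof (cases "B \<in> \<pi>")
    case True
    then show ?thesis unfolding nonaligned_def mem_Collect_eq key[OF True]
      by (simp add: not_less) (meson leD leI)
  next
    case False
    then show ?thesis by (simp add: nonaligned_def)
  qed
qed

text \<open>The block of the largest element of \<open>\<sigma> \<uplus> \<tau> \<star> \<upsilon>\<close>.\<close>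

definition topblock :: "nat set set \<Rightarrow> nat set set \<Rightarrow> nat set set \<Rightarrow> nat set" where
  "topblock \<sigma> \<tau> \<upsilon> = (\<lambda>x. x + psize \<sigma>) ` insert (psize \<tau> + psize \<upsilon> + 1) (lastblock \<tau>)"

text \<open>Each kind of block comes with the region it occupies. The upper bound in the third case
  is strict because the last element of \<open>\<tau>\<close> lies in its last block, which has
  become part of the top block.\<close>

lemma triple_mem:
  assumes "valid \<sigma>" "valid \<tau>" "valid \<upsilon>" "C \<in> \<sigma> \<uplus> \<tau> \<star> \<upsilon>"
  obtains "C = topblock \<sigma> \<tau> \<upsilon>" | "C \<in> \<sigma>" "\<And>x. x \<in> C \<Longrightarrow> x \<le> psize \<sigma>"
  | "\<tau> \<noteq> {}" "\<And>x. x \<in> C \<Longrightarrow> psize \<sigma> < x \<and> x < psize \<sigma> + psize \<tau>" "C \<in> shift (psize \<sigma>) (\<tau> - {lastblock \<tau>})"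
  | "C \<in> shift (psize \<sigma> + psize \<tau>) \<upsilon>"
    "\<And>x. x \<in> C \<Longrightarrow> psize \<sigma> + psize \<tau> < x \<and> x < psize \<sigma> + psize \<tau> + psize \<upsilon> + 1"
proof -
  consider "C = topblock \<sigma> \<tau> \<upsilon>" | "C \<in> \<sigma>" | "C \<in> shift (psize \<sigma>) (\<tau> - {lastblock \<tau>})"
    | "C \<in> shift (psize \<sigma> + psize \<tau>) \<upsilon>"
    using assms(4) unfolding triple_eq[OF assms(1-3)] topblock_def by blast
  then show thesis
  proof cases
    case 1
    then show ?thesis by (rule that(1))
  next
    case 2
    then show ?thesis using that(2) valid_bounds[OF assms(1)] by blast
  next
    case 3
    then obtain C' where C': "C' \<in> \<tau>" "C' \<noteq> lastblock \<tau>" "C = (\<lambda>x. x + psize \<sigma>) ` C'"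
      unfolding shift_def by blast
    have "psize \<tau> \<notin> C'" using lastblock_eq[OF assms(2) C'(1)] C'(2) by blast
    then have "1 \<le> x \<and> x < psize \<tau>" if "x \<in> C'" for x
      using valid_bounds[OF assms(2) C'(1) that] that by (metis le_neq_implies_less)
    then have "psize \<sigma> < x \<and> x < psize \<sigma> + psize \<tau>" if "x \<in> C" for x
      using that unfolding C'(3) by fastforce
    then show ?thesis using that(3) C' 3 by blast
  next
    case 4
    then show ?thesis using that(4) shift_bounds[OF assms(3) 4] by fastforce
  qed
qed

lemma topblock_in: "valid \<sigma> \<Longrightarrow> valid \<tau> \<Longrightarrow> valid \<upsilon> \<Longrightarrow> topblock \<sigma> \<tau> \<upsilon> \<in> \<sigma> \<uplus> \<tau> \<star> \<upsilon>"
  by (simp only: triple_eq topblock_def) blast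

lemma topblock_last: "psize \<sigma> + psize \<tau> + psize \<upsilon> + 1 \<in> topblock \<sigma> \<tau> \<upsilon>"
  unfolding topblock_def by simp

lemma topblock_mem:
  assumes "valid \<tau>"
  shows "x \<in> topblock \<sigma> \<tau> \<upsilon> \<Longrightarrow>
    x = psize \<sigma> + psize \<tau> + psize \<upsilon> + 1 \<or> psize \<sigma> < x \<and> x \<le> psize \<sigma> + psize \<tau>"
  unfolding topblock_def using lastblock_bounds[OF assms] by force

lemma topblock_join: "valid \<tau> \<Longrightarrow> \<tau> \<noteq> {} \<Longrightarrow> psize \<sigma> + psize \<tau> \<in> topblock \<sigma> \<tau> \<upsilon>"
  unfolding topblock_def using lastblock_in[of \<tau>] by auto

text \<open>For nonempty \<open>\<tau>\<close> this is connectedness; if both parts are empty, the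
  new largest element itself is \<open>psize \<sigma> + 1\<close>.\<close>

lemma topblock_first:
  assumes "conn_or_empty \<tau>" "\<tau> = {} \<longrightarrow> \<upsilon> = {}"
  shows "psize \<sigma> + 1 \<in> topblock \<sigma> \<tau> \<upsilon>"
  using assms unfolding conn_or_empty_def topblock_def by (cases "\<tau> = {}") auto

lemma card_topblock:
  assumes "valid \<tau>"
  shows "card (topblock \<sigma> \<tau> \<upsilon>) = card (lastblock \<tau>) + 1"
proof -
  have "finite (lastblock \<tau>)"
    using valid_finite_block[OF assms] lastblock_in[OF assms] by (cases "\<tau> = {}") auto
  moreover have "psize \<tau> + psize \<upsilon> + 1 \<notin> lastblock \<tau>" using lastblock_bounds[OF assms] by fastforce
  moreover have "card (topblock \<sigma> \<tau> \<upsilon>) = card (insert (psize \<tau> + psize \<upsilon> + 1) (lastblock \<tau>))"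
    unfolding topblock_def by (rule card_image) simp
  ultimately show ?thesis by simp
qed

text \<open>The top block runs from \<open>psize \<sigma> + 1\<close> to the largest element and so
  encloses all remaining blocks of \<open>\<tau>\<close> and \<open>\<upsilon>\<close>. A block that
  meets the part \<open>\<sigma>\<close> lies inside it, so nothing new encloses a block of
  \<open>\<sigma>\<close>.\<close>

lemma nonnested_triple:
  assumes v: "valid \<sigma>" "valid \<tau>" "valid \<upsilon>" and \<tau>: "conn_or_empty \<tau>" "\<tau> = {} \<longrightarrow> \<upsilon> = {}"
  shows "nonnested (\<sigma> \<uplus> \<tau> \<star> \<upsilon>) = nonnested \<sigma> \<union> {topblock \<sigma> \<tau> \<upsilon>}"
proof -
  let ?\<pi> = "\<sigma> \<uplus> \<tau> \<star> \<upsilon>" and ?T = "topblock \<sigma> \<tau> \<upsilon>" and ?n = "psize \<sigma> + psize \<tau> + psize \<upsilon> + 1"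
  have \<pi>: "valid ?\<pi>" using valid_triple[OF v] by blast
  have sub: "\<sigma> \<subseteq> ?\<pi>" by (simp add: juxt_eq)
  have below: "C \<in> \<sigma> \<and> (\<forall>y\<in>C. y \<le> psize \<sigma>)" if "C \<in> ?\<pi>" "y \<in> C" "y \<le> psize \<sigma>" for C y
    using v that(1)
  proof (cases rule: triple_mem)
    case 1
    then show ?thesis using topblock_mem[OF v(2)] that by fastforce
  qed (use that in fastforce)+
  show ?thesis
  proof (intro set_eqI iffI)
    fix B assume "B \<in> nonnested ?\<pi>"
    then have nest: "\<exists>x\<in>B. \<not> (i < x \<and> x < j)" if "C \<in> ?\<pi>" "i \<in> C" "j \<in> C" for C i j
      using that unfolding nonnested_iff[OF \<pi>] by blast
    have B: "B \<in> ?\<pi>" using \<open>B \<in> nonnested ?\<pi>\<close> unfolding nonnested_iff[OF \<pi>] by blast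
    note top = nest[OF topblock_in[OF v] topblock_first[OF \<tau>] topblock_last]
    have first: "B = ?T" if "psize \<sigma> + 1 \<in> B"
      by (rule valid_disjoint[OF \<pi> B topblock_in[OF v] that topblock_first[OF \<tau>]])
    show "B \<in> nonnested \<sigma> \<union> {?T}"
      using v B
    proof (cases rule: triple_mem)
      case 1
      then show ?thesis by simp
    next
      case 2
      then have "B \<in> nonnested \<sigma>" unfolding nonnested_iff[OF v(1)] using nest sub by blast
      then show ?thesis by simp
    next
      case 3
      obtain x where x: "x \<in> B" "\<not> (psize \<sigma> + 1 < x \<and> x < ?n)" using top by blast
      then have "x = psize \<sigma> + 1" using 3(2)[OF x(1)] by linarith
      then show ?thesis using first x by simp
    next
      case 4
      obtain x where x: "x \<in> B" "\<not> (psize \<sigma> + 1 < x \<and> x < ?n)" using top by blast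
      then have "x = psize \<sigma> + 1" using 4(2)[OF x(1)] by linarith
      then show ?thesis using first x by simp
    qed
  next
    fix B assume "B \<in> nonnested \<sigma> \<union> {?T}"
    then show "B \<in> nonnested ?\<pi>"
    proof
      assume B: "B \<in> nonnested \<sigma>"
      then have B\<sigma>: "B \<in> \<sigma>" unfolding nonnested_iff[OF v(1)] by blast
      have "\<exists>x\<in>B. \<not> (i < x \<and> x < j)" if C: "C \<in> ?\<pi>" "i \<in> C" "j \<in> C" for C i j
      proof (cases "i \<le> psize \<sigma>")
        case True
        then have "C \<in> \<sigma>" using below[OF C(1,2)] by blast
        then show ?thesis using B C unfolding nonnested_iff[OF v(1)] by blast
      next
        case False
        obtain x where "x \<in> B" using valid_nonempty[OF v(1) B\<sigma>] by blast
        then show ?thesis using False valid_bounds[OF v(1) B\<sigma>, of x] by (intro bexI[of _ x]) auto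
      qed
      then show ?thesis using B\<sigma> sub unfolding nonnested_iff[OF \<pi>] by blast
    next
      assume "B \<in> {?T}"
      then have B: "B = ?T" by simp
      have "\<exists>x\<in>?T. \<not> (i < x \<and> x < j)" if C: "C \<in> ?\<pi>" "i \<in> C" "j \<in> C" for C i j
      proof (cases "i \<le> psize \<sigma>")
        case True
        then have "j \<le> psize \<sigma>" using below[OF C(1,2)] C(3) by blast
        then show ?thesis by (intro bexI[OF _ topblock_last]) simp
      next
        case False
        then show ?thesis by (intro bexI[OF _ topblock_first[OF \<tau>]]) simp
      qed
      then show ?thesis unfolding B nonnested_iff[OF \<pi>] using topblock_in[OF v] by blast
    qed
  qed
qed

text \<open>If \<open>\<tau>\<close> is nonempty, the top block contains an edge from
  \<open>psize \<sigma> + psize \<tau>\<close> to the largest element, and all blocks of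
  \<open>\<sigma>\<close> and the other blocks of \<open>\<tau>\<close> end before it. If
  \<open>\<tau>\<close> is empty, there are no such blocks. Edges starting later lie in the copy of
  \<open>\<upsilon>\<close>, so alignment there is decided by \<open>\<upsilon>\<close>
  alone.\<close>

lemma nonaligned_triple:
  assumes v: "valid \<sigma>" "valid \<tau>" "valid \<upsilon>" and \<tau>: "\<tau> = {} \<longrightarrow> \<sigma> = {}"
  shows "nonaligned (\<sigma> \<uplus> \<tau> \<star> \<upsilon>) =
    shift (psize \<sigma> + psize \<tau>) (nonaligned \<upsilon>) \<union> {topblock \<sigma> \<tau> \<upsilon>}"
proof -
  let ?\<pi> = "\<sigma> \<uplus> \<tau> \<star> \<upsilon>" and ?T = "topblock \<sigma> \<tau> \<upsilon>"
  let ?p = "psize \<sigma> + psize \<tau>"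
  let ?n = "?p + psize \<upsilon> + 1"
  have \<pi>: "valid ?\<pi>" and size: "psize ?\<pi> = ?n" using valid_triple[OF v] by auto
  have sub: "shift ?p \<upsilon> \<subseteq> ?\<pi>" unfolding triple_eq[OF v] by blast
  have above: "C \<in> shift ?p \<upsilon>" if C: "C \<in> ?\<pi>" "i \<in> C" "j \<in> C" "i < j" "?p < i" for C i j
    using v C(1)
  proof (cases rule: triple_mem)
    case 1
    then have "i = ?n" using topblock_mem[OF v(2), of i \<sigma> \<upsilon>] C by auto
    then show ?thesis using valid_bounds[OF \<pi> C(1,3)] size C by auto
  next
    case 2
    then show ?thesis using C by fastforce
  next
    case 3
    then show ?thesis using C by fastforce
  qed
  show ?thesis
  proof (intro set_eqI iffI)
    fix B assume na: "B \<in> nonaligned ?\<pi>"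
    then have B: "B \<in> ?\<pi>" unfolding nonaligned_iff[OF \<pi>] by blast
    have na': "\<exists>x\<in>B. i \<le> x" if "C \<in> ?\<pi>" "i \<in> C" "j \<in> C" "i < j" for C i j
      using na that unfolding nonaligned_iff[OF \<pi>] by blast
    have top: "\<exists>x\<in>B. ?p \<le> x" if "\<tau> \<noteq> {}"
      by (rule na'[OF topblock_in[OF v] topblock_join[OF v(2) that] topblock_last]) simp
    show "B \<in> shift ?p (nonaligned \<upsilon>) \<union> {?T}"
      using v B
    proof (cases rule: triple_mem)
      case 1
      then show ?thesis by simp
    next
      case 2
      then have "\<tau> \<noteq> {}" using \<tau> by blast
      then obtain x where x: "x \<in> B" "?p \<le> x" using top by blast
      then have "psize \<tau> = 0" using 2(2)[OF x(1)] by simp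
      then show ?thesis using valid_psize_0[OF v(2)] \<open>\<tau> \<noteq> {}\<close> by simp
    next
      case 3
      then obtain x where x: "x \<in> B" "?p \<le> x" using top by blast
      then show ?thesis using 3(2)[OF x(1)] by simp
    next
      case 4
      then obtain B' where B': "B' \<in> \<upsilon>" "B = (\<lambda>x. x + ?p) ` B'" unfolding shift_def by blast
      have "\<exists>x\<in>B'. i \<le> x" if C: "C \<in> \<upsilon>" "i \<in> C" "j \<in> C" "i < j" for C i j
      proof -
        have "(\<lambda>x. x + ?p) ` C \<in> ?\<pi>" using sub C(1) unfolding shift_def by blast
        then have "\<exists>x\<in>B. i + ?p \<le> x"
          using na'[of "(\<lambda>x. x + ?p) ` C" "i + ?p" "j + ?p"] C by simp
        then show ?thesis unfolding B'(2) by auto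
      qed
      then have "B' \<in> nonaligned \<upsilon>" using B'(1) unfolding nonaligned_iff[OF v(3)] by blast
      then show ?thesis using B'(2) unfolding shift_def by blast
    qed
  next
    fix B assume "B \<in> shift ?p (nonaligned \<upsilon>) \<union> {?T}"
    then show "B \<in> nonaligned ?\<pi>"
    proof
      assume "B \<in> shift ?p (nonaligned \<upsilon>)"
      then obtain B' where B': "B' \<in> nonaligned \<upsilon>" "B = (\<lambda>x. x + ?p) ` B'" unfolding shift_def by blast
      have B'\<upsilon>: "B' \<in> \<upsilon>" using B'(1) unfolding nonaligned_iff[OF v(3)] by blast
      then have B: "B \<in> shift ?p \<upsilon>" using B'(2) unfolding shift_def by blast
      have "\<exists>x\<in>B. i \<le> x" if C: "C \<in> ?\<pi>" "i \<in> C" "j \<in> C" "i < j" for C i j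
      proof (cases "?p < i")
        case True
        then obtain C' where C': "C' \<in> \<upsilon>" "C = (\<lambda>x. x + ?p) ` C'"
          using above[OF C] unfolding shift_def by blast
        obtain i' j' where ij: "i' \<in> C'" "j' \<in> C'" "i = i' + ?p" "j = j' + ?p"
          using C(2,3) unfolding C'(2) by blast
        then have "\<exists>x\<in>B'. i' \<le> x"
          using B'(1) C'(1) C(4) unfolding nonaligned_iff[OF v(3)] by auto
        then show ?thesis unfolding B'(2) ij(3) by auto
      next
        case False
        obtain x where "x \<in> B" using shift_nonempty[OF v(3) B] by blast
        then show ?thesis using False shift_bounds[OF v(3) B, of x] by (intro bexI[of _ x]) auto
      qed
      then show ?thesis using B sub unfolding nonaligned_iff[OF \<pi>] by blast
    next
      assume "B \<in> {?T}"
      then have B: "B = ?T" by simp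
      have "\<exists>x\<in>?T. i \<le> x" if C: "C \<in> ?\<pi>" "i \<in> C" for C i
        using valid_bounds[OF \<pi> C] size by (intro bexI[OF _ topblock_last]) simp
      then show ?thesis unfolding B nonaligned_iff[OF \<pi>] using topblock_in[OF v] by blast
    qed
  qed
qed

section \<open>Sizes of blocks in the order of their maxima\<close>

text \<open>Hiding the blocks leaves a list that can be compared between different partitions and
  that does not change under shifts. Uniqueness of the enumeration later returns to given lists of
  blocks.\<close>

definition ordered_sizes :: "nat list \<Rightarrow> nat set set \<Rightarrow> bool" where
  "ordered_sizes ks \<A> \<longleftrightarrow> (\<exists>As. ordered_blocks As \<A> \<and> map card As = ks)"

lemma ordered_sizes_empty: "ordered_sizes [] {}"
  unfolding ordered_sizes_def ordered_blocks_def by simp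

lemma ordered_sizes_snoc:
  assumes "ordered_sizes ks \<A>" "\<And>A. A \<in> \<A> \<Longrightarrow> Max A < Max B"
  shows "ordered_sizes (ks @ [card B]) (\<A> \<union> {B})"
proof -
  obtain As where As: "ordered_blocks As \<A>" "map card As = ks"
    using assms(1) unfolding ordered_sizes_def by blast
  then have "ordered_blocks (As @ [B]) (\<A> \<union> {B})"
    using assms(2) unfolding ordered_blocks_def by (simp add: sorted_wrt_append)
  moreover have "map card (As @ [B]) = ks @ [card B]" using As(2) by simp
  ultimately show ?thesis unfolding ordered_sizes_def by blast
qed

lemma Max_shift: "finite B \<Longrightarrow> B \<noteq> {} \<Longrightarrow> Max ((\<lambda>x::nat. x + p) ` B) = Max B + p"
  using Max_add_commute[of B "\<lambda>x. x" p] by simp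

lemma ordered_sizes_shift:
  assumes "ordered_sizes ks \<A>" "\<And>A. A \<in> \<A> \<Longrightarrow> finite A \<and> A \<noteq> {}"
  shows "ordered_sizes ks (shift p \<A>)"
proof -
  let ?f = "\<lambda>B. (\<lambda>x. x + p) ` B"
  obtain As where As: "set As = \<A>" "sorted_wrt (\<lambda>A B. Max A < Max B) As" "map card As = ks"
    using assms(1) unfolding ordered_sizes_def ordered_blocks_def by blast
  have "sorted_wrt (\<lambda>A B. Max A < Max B) (map ?f As)"
    unfolding sorted_wrt_map
    by (rule sorted_wrt_mono_rel[OF _ As(2)]) (simp add: As(1) assms(2) Max_shift)
  moreover have "set (map ?f As) = shift p \<A>" using As(1) by (simp add: shift_def)
  moreover have "map card (map ?f As) = ks" using As(3) by (simp add: card_image comp_def)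
  ultimately show ?thesis unfolding ordered_sizes_def ordered_blocks_def by blast
qed

lemma Max_less_topblock:
  assumes "valid \<tau>" "finite A" "A \<noteq> {}" "\<And>x. x \<in> A \<Longrightarrow> x < psize \<sigma> + psize \<tau> + psize \<upsilon> + 1"
  shows "Max A < Max (topblock \<sigma> \<tau> \<upsilon>)"
proof -
  have "finite (lastblock \<tau>)"
    using valid_finite_block[OF assms(1)] lastblock_in[OF assms(1)] by (cases "\<tau> = {}") auto
  then have "finite (topblock \<sigma> \<tau> \<upsilon>)" unfolding topblock_def by simp
  then have "psize \<sigma> + psize \<tau> + psize \<upsilon> + 1 \<le> Max (topblock \<sigma> \<tau> \<upsilon>)" using topblock_last by (rule Max_ge)
  moreover have "Max A < psize \<sigma> + psize \<tau> + psize \<upsilon> + 1" using assms by simp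
  ultimately show ?thesis by simp
qed

text \<open>The head of the list contributes the block of the largest element, which comes last in
  the order by maxima; hence the reversal. The sizes are written in terms of
  \<open>map fst ps\<close> because this is the list that \<pi> and \<xi>(\<pi>) share.\<close>

lemma ordered_sizes_nonnested_buildL:
  "\<forall>p\<in>set ps. admissible p \<Longrightarrow>
    ordered_sizes (rev (map (\<lambda>\<sigma>. card (lastblock \<sigma>) + 1) (map fst ps))) (nonnested (buildL ps))"
proof (induction ps)
  case (Cons p ps)
  let ?T = "topblock (buildL ps) (fst p) (snd p)"
  have p: "admissible p" and ps: "valid (buildL ps)" using Cons.prems valid_buildL[of ps] by auto
  note p = admissibleD[OF p]
  have "ordered_sizes (rev (map (\<lambda>\<sigma>. card (lastblock \<sigma>) + 1) (map fst ps)) @ [card ?T])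
      (nonnested (buildL ps) \<union> {?T})"
  proof (rule ordered_sizes_snoc)
    fix A assume "A \<in> nonnested (buildL ps)"
    then have A: "A \<in> buildL ps" by (simp add: nonnested_def)
    show "Max A < Max ?T"
      using valid_finite_block[OF ps A] valid_nonempty[OF ps A] valid_bounds[OF ps A]
      by (intro Max_less_topblock[OF p(1)]) fastforce+
  qed (use Cons in simp)
  then show ?case using nonnested_triple[OF ps p(1,2,3)] p(4) card_topblock[OF p(1)] by simp
qed (simp add: nonnested_def ordered_sizes_empty)

text \<open>The top block again comes last, and the shift of the earlier blocks changes neither
  their sizes nor their order, so the same sizes arise as for the nonnested blocks of
  \<open>buildL ps\<close>.\<close>

lemma ordered_sizes_nonaligned_buildR:
  "\<forall>p\<in>set ps. admissible p \<Longrightarrow>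
    ordered_sizes (rev (map (\<lambda>\<sigma>. card (lastblock \<sigma>) + 1) (map fst ps))) (nonaligned (buildR ps))"
proof (induction ps)
  case (Cons p ps)
  let ?T = "topblock (snd p) (fst p) (buildR ps)" and ?p = "psize (snd p) + psize (fst p)"
  have p: "admissible p" and ps: "valid (buildR ps)" using Cons.prems valid_buildR[of ps] by auto
  note p = admissibleD[OF p]
  have sub: "A \<in> buildR ps" if "A \<in> nonaligned (buildR ps)" for A using that by (simp add: nonaligned_def)
  have "ordered_sizes (rev (map (\<lambda>\<sigma>. card (lastblock \<sigma>) + 1) (map fst ps)) @ [card ?T])
      (shift ?p (nonaligned (buildR ps)) \<union> {?T})"
  proof (rule ordered_sizes_snoc)
    show "ordered_sizes (rev (map (\<lambda>\<sigma>. card (lastblock \<sigma>) + 1) (map fst ps)))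
        (shift ?p (nonaligned (buildR ps)))"
      using Cons valid_finite_block[OF ps] valid_nonempty[OF ps] sub
      by (intro ordered_sizes_shift) auto
    fix A assume "A \<in> shift ?p (nonaligned (buildR ps))"
    then have A: "A \<in> shift ?p (buildR ps)" using sub unfolding shift_def by blast
    then have "finite A" using valid_finite_block[OF ps] unfolding shift_def by auto
    then show "Max A < Max ?T"
      using shift_nonempty[OF ps A] shift_bounds[OF ps A]
      by (intro Max_less_topblock[OF p(1)]) fastforce+
  qed
  then show ?case using nonaligned_triple[OF p(2,1) ps] p(4) card_topblock[OF p(1)] by simp
qed (simp add: nonaligned_def ordered_sizes_empty)

lemma ordered_blocks_sizes:
  assumes "valid \<pi>" "\<A> \<subseteq> \<pi>" "ordered_sizes ks \<A>" "ordered_blocks As \<A>"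
  shows "map card As = ks"
  using ordered_blocks_ex1[of \<pi> "psize \<pi>" \<A>] assms unfolding NC_iff ordered_sizes_def by auto

lemma card_ordered_sizes:
  assumes "ordered_sizes ks \<A>"
  shows "card \<A> = length ks"
proof -
  obtain As where As: "set As = \<A>" "sorted_wrt (\<lambda>A B. Max A < Max B) As" "map card As = ks"
    using assms unfolding ordered_sizes_def ordered_blocks_def by blast
  have "sorted_wrt (\<noteq>) As" by (rule sorted_wrt_mono_rel[OF _ As(2)]) auto
  then have "distinct As" by (simp add: distinct_conv_nth sorted_wrt_iff_nth_less) (metis linorder_neqE_nat)
  then show ?thesis using As distinct_card by fastforce
qed

section \<open>Assembling the properties of \<xi>\<close>

text \<open>Provides both readings of \<open>\<pi>\<close> and of \<open>xi \<pi>\<close>. The left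
  list of the one and the right list of the other agree in their first components, though not as
  lists of pairs.\<close>

lemma xi_forms:
  assumes "valid \<pi>"
  obtains Ps Qs Ps' Qs' where
    "\<forall>p\<in>set Ps. admissible p" "\<forall>p\<in>set Qs. admissible p"
    "\<forall>p\<in>set Ps'. admissible p" "\<forall>p\<in>set Qs'. admissible p"
    "\<pi> = buildL Ps" "\<pi> = buildR Qs" "xi \<pi> = buildL Qs'" "xi \<pi> = buildR Ps'"
    "map fst Ps = map fst Ps'" "map fst Qs = map fst Qs'"
    "weight Qs' = weight Ps" "ptype (xi \<pi>) = ptype \<pi>" "xi (xi \<pi>) = \<pi>"
  using assms
proof (cases rule: normal_form)
  case (singletons m)
  let ?P = "replicate m ({}, {}) :: (nat set set \<times> nat set set) list"
  have P: "\<forall>p\<in>set ?P. admissible p" using admissible_empty by auto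
  have R: "buildL ?P = buildR ?P" using build_replicate[of "[]" m] by simp
  have xi: "xi \<pi> = \<pi>" unfolding singletons by (rule xi_singletons)
  show ?thesis
    by (rule that[of ?P ?P ?P ?P]) (use P R xi singletons in simp_all)
next
  case (core m \<sigma> ps qs)
  let ?E = "replicate m ({}, {}) :: (nat set set \<times> nat set set) list"
  let ?P = "?E @ (\<sigma>, buildR qs) # ps" and ?Q = "?E @ (\<sigma>, buildL ps) # qs"
  let ?P' = "?E @ (\<sigma>, buildL qs) # ps" and ?Q' = "?E @ (\<sigma>, buildR ps) # qs"
  note ps = valid_buildL[OF core(1)] valid_buildR[OF core(1)]
    and qs = valid_buildL[OF core(2)] valid_buildR[OF core(2)]
  have "\<forall>p\<in>set (?E @ (\<sigma>, \<upsilon>) # xs). admissible p"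
    if "valid \<upsilon>" "\<forall>p\<in>set xs. admissible p" for \<upsilon> xs
    using that core(3-5) admissible_empty by (auto simp: admissible_def[of "(\<sigma>, \<upsilon>)"])
  then have adm: "\<forall>p\<in>set ?P. admissible p" "\<forall>p\<in>set ?Q. admissible p"
    "\<forall>p\<in>set ?P'. admissible p" "\<forall>p\<in>set ?Q'. admissible p"
    using core(1,2) ps qs by blast+
  have xi: "xi \<pi> = buildL ?Q'" unfolding core(6) by (rule xi_buildL[OF core(1-5)])
  have xi2: "xi (xi \<pi>) = \<pi>" unfolding xi using xi_buildL[OF core(2,1,3-5)] core(6) by simp
  show ?thesis
  proof (rule that[OF adm core(6) _ xi])
    show "\<pi> = buildR ?Q" unfolding core(6) by (rule buildL_eq_buildR[OF core(1-5)])
    show "xi \<pi> = buildR ?P'" unfolding xi by (rule buildL_eq_buildR[OF core(2,1,3-5)])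
    show "weight ?Q' = weight ?P" using ps qs by (simp add: weight_def)
    \<comment> \<open>Apart from \<open>\<sigma>\<close> and the singletons, the lists
      \<open>?P\<close> and \<open>?Q'\<close> contribute the types of \<open>ps\<close> and
      \<open>qs\<close>, each read once from the left or from the right, and both readings give the
      same sum.\<close>
    show "ptype (xi \<pi>) = ptype \<pi>"
      unfolding xi unfolding core(6) ptype_build(1)[OF adm(4)] ptype_build(1)[OF adm(1)]
      using ptype_build[OF core(1)] ptype_build[OF core(2)] by (simp add: ac_simps)
  qed (use xi2 in simp_all)
qed

lemma xi_properties:
  assumes "\<pi> \<in> NC n"
  shows "xi \<pi> \<in> NC n" "xi (xi \<pi>) = \<pi>" "ptype (xi \<pi>) = ptype \<pi>"
    "\<exists>ks. ordered_sizes ks (nonnested \<pi>) \<and> ordered_sizes ks (nonaligned (xi \<pi>))"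
proof -
  have v: "valid \<pi>" and size: "psize \<pi> = n" using assms by (auto simp: NC_iff)
  obtain Ps Qs Ps' Qs' where adm: "\<forall>p\<in>set Ps. admissible p" "\<forall>p\<in>set Qs. admissible p"
      "\<forall>p\<in>set Ps'. admissible p" "\<forall>p\<in>set Qs'. admissible p"
    and eq: "\<pi> = buildL Ps" "\<pi> = buildR Qs" "xi \<pi> = buildL Qs'" "xi \<pi> = buildR Ps'"
      "map fst Ps = map fst Ps'" "map fst Qs = map fst Qs'"
      "weight Qs' = weight Ps" "ptype (xi \<pi>) = ptype \<pi>" "xi (xi \<pi>) = \<pi>"
    using v by (rule xi_forms)
  show "xi \<pi> \<in> NC n"
    using valid_buildL[OF adm(4)] valid_buildL[OF adm(1)] size eq(1,3,7) by (simp add: NC_iff)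
  show "xi (xi \<pi>) = \<pi>" "ptype (xi \<pi>) = ptype \<pi>" by (fact eq)+
  show "\<exists>ks. ordered_sizes ks (nonnested \<pi>) \<and> ordered_sizes ks (nonaligned (xi \<pi>))"
    using ordered_sizes_nonnested_buildL[OF adm(1)] ordered_sizes_nonaligned_buildR[OF adm(3)]
    unfolding eq(1)[symmetric] eq(4)[symmetric] eq(5) by blast
qed

theorem theorem5p4:
  fixes n :: nat
  assumes "n \<ge> 1"
  shows
    "xi \<in> NC n \<rightarrow> NC n \<and>
     (\<forall>\<pi>\<in>NC n. xi (xi \<pi>) = \<pi>) \<and>
     (\<forall>\<pi>\<in>NC n. ptype (xi \<pi>) = ptype \<pi> \<and> nn (xi \<pi>) = na \<pi> \<and> na (xi \<pi>) = nn \<pi>) \<and>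
     (\<forall>\<pi>\<in>NC n. \<forall>N N' A A'.
        ordered_blocks N (nonnested \<pi>) \<longrightarrow> ordered_blocks N' (nonnested (xi \<pi>)) \<longrightarrow>
        ordered_blocks A (nonaligned \<pi>) \<longrightarrow> ordered_blocks A' (nonaligned (xi \<pi>)) \<longrightarrow>
        length A' = length N \<and> (\<forall>i<length N. card (N ! i) = card (A' ! i)) \<and>
        length N' = length A \<and> (\<forall>j<length A. card (A ! j) = card (N' ! j)))"
proof (intro conjI ballI funcsetI allI impI)
  have sub: "nonnested \<rho> \<subseteq> \<rho>" "nonaligned \<rho> \<subseteq> \<rho>" for \<rho> by (auto simp: nonnested_def nonaligned_def)
  \<comment> \<open>One direction suffices: the other one is the same statement for
    \<open>xi \<pi>\<close>, because \<xi> is an involution.\<close>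
  have half: "na (xi \<rho>) = nn \<rho>"
    and half_list: "ordered_blocks N (nonnested \<rho>) \<Longrightarrow> ordered_blocks A' (nonaligned (xi \<rho>)) \<Longrightarrow>
      map card N = map card A'" if \<rho>: "\<rho> \<in> NC n" for \<rho> N A'
  proof -
    obtain ks where ks: "ordered_sizes ks (nonnested \<rho>)" "ordered_sizes ks (nonaligned (xi \<rho>))"
      using xi_properties(4)[OF \<rho>] by blast
    show "na (xi \<rho>) = nn \<rho>" using card_ordered_sizes[OF ks(1)] card_ordered_sizes[OF ks(2)]
      by (simp add: na_def nn_def)
    have "valid \<rho>" "valid (xi \<rho>)" using \<rho> xi_properties(1)[OF \<rho>] by (auto simp: NC_iff)
    then show "map card N = map card A'"
      if "ordered_blocks N (nonnested \<rho>)" "ordered_blocks A' (nonaligned (xi \<rho>))"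
      using ordered_blocks_sizes[OF _ sub(1) ks(1) that(1)] ordered_blocks_sizes[OF _ sub(2) ks(2) that(2)]
      by simp
  qed
  fix \<pi> assume \<pi>: "\<pi> \<in> NC n"
  note p = xi_properties[OF \<pi>]
  show "xi \<pi> \<in> NC n" "xi (xi \<pi>) = \<pi>" "ptype (xi \<pi>) = ptype \<pi>" by (fact p)+
  show "nn (xi \<pi>) = na \<pi>" "na (xi \<pi>) = nn \<pi>" using half[OF p(1)] half[OF \<pi>] p(2) by simp_all
  fix N N' A A'
  assume "ordered_blocks N (nonnested \<pi>)" "ordered_blocks N' (nonnested (xi \<pi>))"
    "ordered_blocks A (nonaligned \<pi>)" "ordered_blocks A' (nonaligned (xi \<pi>))"
  then have eq: "map card N = map card A'" "map card N' = map card A"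
    using half_list[OF \<pi>] half_list[OF p(1)] p(2) by simp_all
  then show len: "length A' = length N" "length N' = length A" by (metis length_map)+
  show "card (N ! i) = card (A' ! i)" if "i < length N" for i
    using arg_cong[OF eq(1), of "\<lambda>xs. xs ! i"] that len by simp
  show "card (A ! j) = card (N' ! j)" if "j < length A" for j
    using arg_cong[OF eq(2), of "\<lambda>xs. xs ! j"] that len by simp
qed

end
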